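(* Let $U:\mathbb{R}^d\to\mathbb{R}$ be continuously differentiable, and let $L\ge 0$, $m>0$ be such that for all $x,y\in\mathbb{R}^d$, $\|\nabla U(x)-\nabla U(y)\|\le L\|x-y\|$ and $U(y)\ge U(x)+\langle\nabla U(x),y-x\rangle+(m/2)\|x-y\|^2$. Let $(\gamma_k)_{k\ge1}$ be a non-increasing sequence of positive real numbers with $\gamma_1\le2/(m+L)$. Then for all $N\ge0$, $n\ge1$, $r>0$, all Lipschitz functions $f:\mathbb{R}^d\to\mathbb{R}$ and every starting point $x\in\mathbb{R}^d$, $$\mathbb{P}_x\left[\hat\pi_n^N(f)\ge\mathbb{E}_x[\hat\pi_n^N(f)]+r\right]\le\exp\left(-\frac{r^2\kappa^2\,\Gamma_{N+2,N+n+1}}{16\|f\|_{\mathrm{Lip}}^2\,v_{N,n}(\gamma)}\right),$$ where $v_{N,n}(\gamma)=1+\Gamma_{N+2,N+n+1}^{-1}\left(\kappa^{-1}+2/(m+L)\right)$.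
   Context: Here $d\ge1$, $\kappa=2mL/(m+L)$, $\Gamma_{n,\ell}=\sum_{k=n}^\ell\gamma_k$. $(X_k)_{k\ge0}$ is the unadjusted Langevin chain $X_{k+1}=X_k-\gamma_{k+1}\nabla U(X_k)+\sqrt{2\gamma_{k+1}}Z_{k+1}$, where $(Z_k)_{k\ge1}$ are i.i.d. standard $d$-dimensional Gaussian vectors; $\mathbb{P}_x,\mathbb{E}_x$ refer to the chain with $X_0=x$. The weighted average estimator is $\hat\pi_n^N(f)=\sum_{k=N+1}^{N+n}\omega_{k,n}^Nf(X_k)$ with $\omega_{k,n}^N=\gamma_{k+1}\Gamma_{N+2,N+n+1}^{-1}$. $\|f\|_{\mathrm{Lip}}=\sup_{x\ne y}|f(x)-f(y)|/\|x-y\|$ is the Lipschitz constant of $f$. *)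

theory Defs
  imports "HOL-Probability.Probability"
begin

definition std_gaussian_density :: "real ^ 'n \<Rightarrow> real" where
  "std_gaussian_density z = (\<Prod>i\<in>UNIV. std_normal_density (z $ i))"

text \<open>Only the noise variables with index at least 1 are used by the chain, so nothing is
  required of \<open>Z 0\<close>.\<close>

definition iid_std_gaussian :: "'w measure \<Rightarrow> (nat \<Rightarrow> 'w \<Rightarrow> real ^ 'n) \<Rightarrow> bool" where
  "iid_std_gaussian M Z \<longleftrightarrow>
     prob_space.indep_vars M (\<lambda>_. borel) Z {1..} \<and>
     (\<forall>k\<ge>1. distributed M lborel (Z k) (\<lambda>z. ennreal (std_gaussian_density z)))"

primrec ula_chain ::
  "(real ^ 'n \<Rightarrow> real ^ 'n) \<Rightarrow> (nat \<Rightarrow> real) \<Rightarrow> (nat \<Rightarrow> 'w \<Rightarrow> real ^ 'n) \<Rightarrow> real ^ 'n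
     \<Rightarrow> nat \<Rightarrow> 'w \<Rightarrow> real ^ 'n" where
  "ula_chain gradU \<gamma> Z x 0 \<omega> = x"
| "ula_chain gradU \<gamma> Z x (Suc k) \<omega> =
     ula_chain gradU \<gamma> Z x k \<omega> - \<gamma> (Suc k) *\<^sub>R gradU (ula_chain gradU \<gamma> Z x k \<omega>)
     + sqrt (2 * \<gamma> (Suc k)) *\<^sub>R Z (Suc k) \<omega>"

definition step_sum :: "(nat \<Rightarrow> real) \<Rightarrow> nat \<Rightarrow> nat \<Rightarrow> real" where
  "step_sum \<gamma> n l = (\<Sum>k=n..l. \<gamma> k)"

definition avg_weight :: "(nat \<Rightarrow> real) \<Rightarrow> nat \<Rightarrow> nat \<Rightarrow> nat \<Rightarrow> real" where
  "avg_weight \<gamma> N n k = \<gamma> (k + 1) / step_sum \<gamma> (N + 2) (N + n + 1)"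

definition weighted_avg ::
  "(nat \<Rightarrow> real) \<Rightarrow> (nat \<Rightarrow> 'w \<Rightarrow> real ^ 'n) \<Rightarrow> nat \<Rightarrow> nat \<Rightarrow> (real ^ 'n \<Rightarrow> real) \<Rightarrow> 'w \<Rightarrow> real" where
  "weighted_avg \<gamma> X N n f \<omega> = (\<Sum>k=N+1..N+n. avg_weight \<gamma> N n k * f (X k \<omega>))"

text \<open>The supremum is taken in the reals, so this is the Lipschitz constant only for
  functions \<open>f\<close> that are Lipschitz.\<close>

definition lip_const :: "(real ^ 'n \<Rightarrow> real) \<Rightarrow> real" where
  "lip_const f = (SUP (x, y) \<in> {(x, y). x \<noteq> y}. \<bar>f x - f y\<bar> / norm (x - y))"

definition kappa :: "real \<Rightarrow> real \<Rightarrow> real" where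
  "kappa m L = 2 * m * L / (m + L)"

definition v_const :: "real \<Rightarrow> real \<Rightarrow> (nat \<Rightarrow> real) \<Rightarrow> nat \<Rightarrow> nat \<Rightarrow> real" where
  "v_const m L \<gamma> N n =
     1 + (1 / kappa m L + 2 / (m + L)) / step_sum \<gamma> (N + 2) (N + n + 1)"

text \<open>For constant \<open>f\<close> the exponent has denominator zero and is read as minus infinity, so the
  bound is 0. This case has to be separated because HOL's \<open>a / 0 = 0\<close> would turn the bound into 1.\<close>

definition concentration_bound ::
  "real \<Rightarrow> real \<Rightarrow> (nat \<Rightarrow> real) \<Rightarrow> nat \<Rightarrow> nat \<Rightarrow> (real ^ 'n \<Rightarrow> real) \<Rightarrow> real \<Rightarrow> real" where
  "concentration_bound m L \<gamma> N n f r =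
     (if lip_const f = 0 then 0
      else exp (- (r\<^sup>2 * (kappa m L)\<^sup>2 * step_sum \<gamma> (N + 2) (N + n + 1)
                   / (16 * (lip_const f)\<^sup>2 * v_const m L \<gamma> N n))))"

end

theory Submission
  imports Defs
begin

text \<open>The estimator is a deterministic function of the noise vectors \<open>Z 1, \<dots>, Z (N + n)\<close>. A gradient
  step with step size \<open>g\<close> contracts by the factor \<open>sqrt (1 - \<kappa> * g)\<close>, so this function is Lipschitz
  for the Euclidean norm of the whole noise, with squared constant at most \<open>8 F\<^sup>2 v / (\<kappa>\<^sup>2 \<Gamma>)\<close>,
  where \<open>F\<close> is the Lipschitz constant of \<open>f\<close>. Gaussian concentration with the sharp constant then
  gives the bound.

  The sharp Gaussian moment generating function comes from the Prekopa--Leindler inequality with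
  weights \<open>1 / (k + 1)\<close> and \<open>k / (k + 1)\<close>. It tensorises, so the one-dimensional case suffices.
  Applied to \<open>exp h\<close> and \<open>exp (- h / k)\<close> for a \<open>\<sigma>\<close>-Lipschitz \<open>h\<close>, and combined with Jensen's
  inequality for the second factor, it bounds the mean of \<open>exp h\<close> by
  \<open>exp (E h + \<sigma>\<^sup>2 / 2 * (1 + 1 / k))\<close>; let \<open>k\<close> tend to infinity.\<close>

subsection \<open>The Prekopa--Leindler inequality on the line\<close>

lemma emeasure_lborel_affine_preimage:
  fixes S :: "real set"
  assumes [measurable]: "S \<in> sets borel" and c: "c > 0"
  shows "emeasure lborel {z. (z - d) / c \<in> S} = ennreal c * emeasure lborel S"
proof -
  have [measurable]: "{z. (z - d) / c \<in> S} \<in> sets borel" by measurable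
  have "emeasure lborel {z. (z - d) / c \<in> S}
      = (\<integral>\<^sup>+z. indicator {z. (z - d) / c \<in> S} z \<partial>lborel)"
    by simp
  also have "\<dots> = ennreal c * (\<integral>\<^sup>+x. indicator {z. (z - d) / c \<in> S} (d + c * x) \<partial>lborel)"
    using c by (subst nn_integral_real_affine[where c = c and t = d]) auto
  also have "(\<lambda>x. indicator {z. (z - d) / c \<in> S} (d + c * x)) = (indicator S :: real \<Rightarrow> ennreal)"
    using c by (auto simp: indicator_def fun_eq_iff)
  finally show ?thesis by simp
qed

text \<open>The dilates of \<open>A\<close> and \<open>B\<close>, shifted by \<open>s * b\<close>
  and \<open>t * a\<close> with \<open>b\<close> close to the infimum of \<open>B\<close> and
  \<open>a\<close> close to the supremum of \<open>A\<close>, both lie in \<open>C\<close> and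
  overlap in an interval of length at most \<open>e\<close>. Asking for an inclusion into a Borel
  set \<open>C\<close> avoids the question whether the Minkowski sum is measurable.\<close>

lemma brunn_minkowski_real_bounded:
  fixes A B C :: "real set"
  assumes A[measurable]: "A \<in> sets borel" and B[measurable]: "B \<in> sets borel"
    and C[measurable]: "C \<in> sets borel"
    and ne: "A \<noteq> {}" "B \<noteq> {}" and bdd: "bdd_above A" "bdd_below B"
    and pos: "t > 0" "s > 0"
    and sub: "\<And>a b. a \<in> A \<Longrightarrow> b \<in> B \<Longrightarrow> t * a + s * b \<in> C"
  shows "ennreal t * emeasure lborel A + ennreal s * emeasure lborel B \<le> emeasure lborel C"
proof (rule ennreal_le_epsilon)
  fix e :: real assume e: "e > 0"
  define \<delta> where "\<delta> = e / (t + s)"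
  have d: "\<delta> > 0" using e pos by (simp add: \<delta>_def)
  obtain a where a: "a \<in> A" "Sup A - \<delta> < a"
    using less_cSupE[of "Sup A - \<delta>" A] d ne by auto
  obtain b where b: "b \<in> B" "b < Inf B + \<delta>"
    using cInf_lessD[of B "Inf B + \<delta>"] d ne by auto
  define P where "P = {z. (z - s * b) / t \<in> A}"
  define Q where "Q = {z. (z - t * a) / s \<in> B}"
  have [measurable]: "P \<in> sets borel" "Q \<in> sets borel" unfolding P_def Q_def by measurable
  have PC: "P \<subseteq> C"
  proof
    fix z assume "z \<in> P"
    then have "t * ((z - s * b) / t) + s * b \<in> C" using sub b unfolding P_def by blast
    moreover have "t * ((z - s * b) / t) + s * b = z" using pos by simp
    ultimately show "z \<in> C" by metis
  qed
  have QC: "Q \<subseteq> C"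
  proof
    fix z assume "z \<in> Q"
    then have "t * a + s * ((z - t * a) / s) \<in> C" using sub a unfolding Q_def by blast
    moreover have "t * a + s * ((z - t * a) / s) = z" using pos by simp
    ultimately show "z \<in> C" by metis
  qed
  have "P \<inter> Q \<subseteq> {t * a + s * Inf B .. t * Sup A + s * b}"
  proof
    fix z assume z: "z \<in> P \<inter> Q"
    then have "(z - s * b) / t \<le> Sup A" "Inf B \<le> (z - t * a) / s"
      using bdd by (auto simp: P_def Q_def intro: cSup_upper cInf_lower)
    then show "z \<in> {t * a + s * Inf B .. t * Sup A + s * b}"
      using pos by (auto simp: field_simps)
  qed
  then have "emeasure lborel (P \<inter> Q) \<le> emeasure lborel {t * a + s * Inf B .. t * Sup A + s * b}"
    by (intro emeasure_mono) auto
  also have "\<dots> \<le> ennreal e"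
  proof -
    have "t * (Sup A - a) + s * (b - Inf B) \<le> t * \<delta> + s * \<delta>"
      using a b pos by (intro add_mono mult_left_mono) auto
    also have "\<dots> = (t + s) * \<delta>" by (simp add: distrib_right)
    also have "\<dots> = e" using pos by (simp add: \<delta>_def)
    finally show ?thesis using e
      by (auto simp: emeasure_lborel_Icc_eq algebra_simps intro!: ennreal_leI)
  qed
  finally have small: "emeasure lborel (P \<inter> Q) \<le> ennreal e" .
  have "ennreal t * emeasure lborel A + ennreal s * emeasure lborel B
      = emeasure lborel P + emeasure lborel Q"
    unfolding P_def Q_def using pos by (simp add: emeasure_lborel_affine_preimage)
  also have "\<dots> = emeasure lborel (P \<union> Q) + emeasure lborel (P \<inter> Q)"
    by (rule emeasure_Un_Int) auto
  also have "\<dots> \<le> emeasure lborel C + ennreal e"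
    using PC QC small by (intro add_mono emeasure_mono) auto
  finally show "ennreal t * emeasure lborel A + ennreal s * emeasure lborel B
      \<le> emeasure lborel C + ennreal e" .
qed

lemma brunn_minkowski_real:
  fixes A B C :: "real set"
  assumes A[measurable]: "A \<in> sets borel" and B[measurable]: "B \<in> sets borel"
    and C: "C \<in> sets borel"
    and ne: "A \<noteq> {}" "B \<noteq> {}" and pos: "t > 0" "s > 0"
    and sub: "\<And>a b. a \<in> A \<Longrightarrow> b \<in> B \<Longrightarrow> t * a + s * b \<in> C"
  shows "ennreal t * emeasure lborel A + ennreal s * emeasure lborel B \<le> emeasure lborel C"
proof -
  define tr where "tr S n = S \<inter> {- real n .. real n}" for S n
  have lim: "(\<lambda>n. emeasure lborel (tr S n)) \<longlonglongrightarrow> emeasure lborel S" if "S \<in> sets borel" for S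
  proof -
    have "(\<Union>n. tr S n) = S"
    proof -
      have "\<exists>n. - real n \<le> x \<and> x \<le> real n" for x :: real
        using real_arch_simple[of "\<bar>x\<bar>"] by (auto simp: abs_le_iff intro: minus_le_iff[THEN iffD1])
      then show ?thesis by (auto simp: tr_def)
    qed
    moreover have "incseq (tr S)" by (auto simp: incseq_def tr_def)
    moreover have "range (tr S) \<subseteq> sets lborel" using that by (auto simp: tr_def)
    ultimately show ?thesis using Lim_emeasure_incseq[of "tr S" lborel] by simp
  qed
  obtain a b where ab: "a \<in> A" "b \<in> B" using ne by auto
  \<comment> \<open>The fixed points \<open>a\<close> and \<open>b\<close> keep the truncated sets
    non-empty for all large \<open>n\<close>, as the bounded case requires.\<close>
  have "\<forall>\<^sub>F n in sequentially. \<bar>a\<bar> \<le> real n \<and> \<bar>b\<bar> \<le> real n"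
    by (intro eventually_conj) real_asymp+
  then have ev: "\<forall>\<^sub>F n in sequentially. ennreal t * emeasure lborel (tr A n)
      + ennreal s * emeasure lborel (tr B n) \<le> emeasure lborel C"
  proof eventually_elim
    case (elim n)
    show ?case
    proof (rule brunn_minkowski_real_bounded[OF _ _ C _ _ _ _ pos])
      show "tr A n \<noteq> {}" "tr B n \<noteq> {}" using ab elim by (auto simp: tr_def abs_le_iff minus_le_iff)
      show "bdd_above (tr A n)" "bdd_below (tr B n)" by (auto simp: tr_def)
    qed (auto simp: tr_def sub)
  qed
  have "(\<lambda>n. ennreal t * emeasure lborel (tr A n) + ennreal s * emeasure lborel (tr B n))
      \<longlonglongrightarrow> ennreal t * emeasure lborel A + ennreal s * emeasure lborel B"
    by (intro tendsto_add ennreal_tendsto_cmult lim) auto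
  from tendsto_upperbound[OF this ev] show ?thesis by simp
qed

text \<open>Tonelli's theorem for the region under the graph. Only heights \<open>u > 0\<close>
  count because \<open>ennreal\<close> sends negative values of \<open>f\<close> to 0.\<close>

lemma nn_integral_layer_cake:
  fixes f :: "real \<Rightarrow> real"
  assumes [measurable]: "f \<in> borel_measurable borel"
  shows "(\<integral>\<^sup>+x. ennreal (f x) \<partial>lborel)
    = (\<integral>\<^sup>+u. indicator {0<..} u * emeasure lborel {x. u < f x} \<partial>lborel)"
proof -
  have "(\<integral>\<^sup>+x. ennreal (f x) \<partial>lborel) = (\<integral>\<^sup>+x. \<integral>\<^sup>+u. indicator {p. 0 < fst p \<and> fst p < f (snd p)} (u, x) \<partial>lborel \<partial>lborel)"
  proof (rule nn_integral_cong)
    fix x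
    have "(\<lambda>u. indicator {p. 0 < fst p \<and> fst p < f (snd p)} (u, x)) = (indicator {0<..<f x} :: real \<Rightarrow> ennreal)"
      by (auto simp: indicator_def fun_eq_iff)
    then have "(\<integral>\<^sup>+u. indicator {p. 0 < fst p \<and> fst p < f (snd p)} (u, x) \<partial>lborel) = emeasure lborel {0<..<f x}"
      by simp
    also have "\<dots> = ennreal (f x)"
      by (cases "0 \<le> f x") (auto simp: ennreal_neg)
    finally show "ennreal (f x) = (\<integral>\<^sup>+u. indicator {p. 0 < fst p \<and> fst p < f (snd p)} (u, x) \<partial>lborel)" by simp
  qed
  also have "\<dots> = (\<integral>\<^sup>+u. \<integral>\<^sup>+x. indicator {p. 0 < fst p \<and> fst p < f (snd p)} (u, x) \<partial>lborel \<partial>lborel)"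
    by (rule lborel_pair.Fubini') measurable
  also have "\<dots> = (\<integral>\<^sup>+u. indicator {0<..} u * emeasure lborel {x. u < f x} \<partial>lborel)"
  proof (rule nn_integral_cong)
    fix u :: real
    have "(\<integral>\<^sup>+x. indicator {p. 0 < fst p \<and> fst p < f (snd p)} (u, x) \<partial>lborel)
       = (\<integral>\<^sup>+x. indicator {0<..} u * indicator {x. u < f x} x \<partial>lborel)"
      by (auto intro!: nn_integral_cong simp: indicator_def)
    also have "\<dots> = indicator {0<..} u * emeasure lborel {x. u < f x}"
      by (subst nn_integral_cmult) auto
    finally show "(\<integral>\<^sup>+x. indicator {p. 0 < fst p \<and> fst p < f (snd p)} (u, x) \<partial>lborel) = \<dots>" .
  qed
  finally show ?thesis .
qed

text \<open>With both suprema normalised to 1, no superlevel set at height below 1 is empty, so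
  Brunn--Minkowski applies at every height.\<close>

lemma prekopa_leindler_real_normalised:
  fixes f g h :: "real \<Rightarrow> real"
  assumes [measurable]: "f \<in> borel_measurable borel" "g \<in> borel_measurable borel"
      "h \<in> borel_measurable borel"
    and le1: "\<And>x. f x \<le> 1" "\<And>x. g x \<le> 1"
    and sup1: "\<And>u. u < 1 \<Longrightarrow> \<exists>x. u < f x" "\<And>u. u < 1 \<Longrightarrow> \<exists>x. u < g x"
    and pos: "t > 0" "s > 0"
    and level: "\<And>u a b. 0 < u \<Longrightarrow> u < f a \<Longrightarrow> u < g b \<Longrightarrow> u < h (t * a + s * b)"
  shows "ennreal t * (\<integral>\<^sup>+x. f x \<partial>lborel) + ennreal s * (\<integral>\<^sup>+x. g x \<partial>lborel) \<le> (\<integral>\<^sup>+x. h x \<partial>lborel)"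
proof -
  have [measurable]: "(\<lambda>u. emeasure lborel {x. u < F x}) \<in> borel_measurable borel"
    if [measurable]: "F \<in> borel_measurable borel" for F :: "real \<Rightarrow> real"
    by measurable
  have "ennreal t * (\<integral>\<^sup>+x. f x \<partial>lborel) + ennreal s * (\<integral>\<^sup>+x. g x \<partial>lborel)
     = (\<integral>\<^sup>+u. ennreal t * (indicator {0<..} u * emeasure lborel {x. u < f x})
           + ennreal s * (indicator {0<..} u * emeasure lborel {x. u < g x}) \<partial>lborel)"
    by (simp add: nn_integral_layer_cake nn_integral_add nn_integral_cmult)
  also have "\<dots> \<le> (\<integral>\<^sup>+u. indicator {0<..} u * emeasure lborel {x. u < h x} \<partial>lborel)"
  proof (rule nn_integral_mono)
    fix u :: real
    consider "u \<le> 0" | "0 < u" "u < 1" | "u \<ge> 1" by linarith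
    then show "ennreal t * (indicator {0<..} u * emeasure lborel {x. u < f x})
           + ennreal s * (indicator {0<..} u * emeasure lborel {x. u < g x})
        \<le> indicator {0<..} u * emeasure lborel {x. u < h x}"
    proof cases
      case 2
      have "ennreal t * emeasure lborel {x. u < f x} + ennreal s * emeasure lborel {x. u < g x}
        \<le> emeasure lborel {x. u < h x}"
        using 2 sup1 pos level by (intro brunn_minkowski_real) auto
      then show ?thesis using 2 by simp
    next
      case 3
      then have "{x. u < f x} = {}" "{x. u < g x} = {}"
        using le1 by (auto simp: not_less intro: order_trans)
      then show ?thesis by (simp del: Collect_empty_eq)
    qed auto
  qed
  also have "\<dots> = (\<integral>\<^sup>+x. h x \<partial>lborel)" by (simp add: nn_integral_layer_cake)
  finally show ?thesis .
qed

text \<open>After division by \<open>y ^ Suc k\<close> this is Bernoulli's inequality at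
  \<open>u\<close>, where \<open>1 + u\<close> is the ratio of the weighted mean to
  \<open>y\<close>.\<close>

lemma weighted_arith_geo_mean:
  fixes x y :: real
  assumes "x \<ge> 0" "y \<ge> 0" "k \<ge> 1"
  shows "x * y ^ k \<le> ((x + real k * y) / (real k + 1)) ^ Suc k"
proof (cases "y = 0")
  case True
  then show ?thesis using assms by (auto simp: power_0_left)
next
  case False
  then have y: "y > 0" using assms by simp
  define u where "u = (x + real k * y) / ((real k + 1) * y) - 1"
  have "(real k + 1) * (u + 1) = (x + real k * y) / y"
    by (simp add: u_def)
  also have "\<dots> = x / y + real k" using y by (simp add: add_divide_distrib)
  finally have "(real k + 1) * (u + 1) = x / y + real k" .
  moreover have "-1 \<le> u" using y assms by (simp add: u_def)
  then have "1 + real (Suc k) * u \<le> (1 + u) ^ Suc k"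
    by (rule Bernoulli_inequality)
  ultimately have "x / y \<le> (1 + u) ^ Suc k" by (simp add: algebra_simps)
  then have "x / y * y ^ Suc k \<le> (1 + u) ^ Suc k * y ^ Suc k"
    using y by (intro mult_right_mono) auto
  also have "\<dots> = ((x + real k * y) / (real k + 1)) ^ Suc k"
    using y by (simp add: u_def power_mult_distrib[symmetric] del: power_Suc)
  finally show ?thesis using y by simp
qed

text \<open>Since \<open>p\<close> is at most 1, the hypothesis bounds \<open>A\<close> and
  \<open>B\<close> as soon as neither vanishes identically, so both can be divided by their suprema.
  The normalised inequality then bounds the arithmetic mean of the rescaled integrals, and weighted
  AM-GM passes to their product.\<close>

lemma prekopa_leindler_real:
  fixes A B :: "real \<Rightarrow> ennreal" and p :: "real \<Rightarrow> real"
  assumes k: "k \<ge> 1" and [measurable]: "A \<in> borel_measurable borel" "B \<in> borel_measurable borel"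
      "p \<in> borel_measurable borel"
    and p0: "\<And>x. p x \<ge> 0" and p1: "\<And>x. p x \<le> 1"
    and int_p: "(\<integral>\<^sup>+x. p x \<partial>lborel) = 1"
    and AB: "\<And>a b. A a * B b ^ k \<le> ennreal (p (1 / (real k + 1) * a + real k / (real k + 1) * b) ^ Suc k)"
  shows "(\<integral>\<^sup>+x. A x \<partial>lborel) * (\<integral>\<^sup>+x. B x \<partial>lborel) ^ k \<le> 1"
proof (cases "(\<forall>x. A x = 0) \<or> (\<forall>x. B x = 0)")
  case True
  then show ?thesis using k by (auto simp: power_0_left)
next
  case False
  then obtain a0 b0 where a0: "A a0 \<noteq> 0" and b0: "B b0 \<noteq> 0" by auto
  have AB1: "A a * B b ^ k \<le> 1" for a b
  proof -
    have "p (1 / (real k + 1) * a + real k / (real k + 1) * b) ^ Suc k \<le> 1"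
      by (rule power_le_one[OF p0 p1])
    then have "ennreal (p (1 / (real k + 1) * a + real k / (real k + 1) * b) ^ Suc k) \<le> ennreal 1"
      by (rule ennreal_leI)
    then show ?thesis using AB[of a b] by (auto intro: order_trans)
  qed
  have Bpow: "B b0 ^ k \<noteq> 0" using b0 k by simp
  have nle: "\<not> (\<top>::ennreal) \<le> 1" by (simp add: not_le)
  have finA: "A a < \<top>" for a
  proof (rule ccontr)
    assume "\<not> A a < \<top>"
    then have "A a * B b0 ^ k = \<top>" using Bpow by (simp add: less_top[symmetric] ennreal_top_mult)
    then show False using AB1[of a b0] nle by simp
  qed
  have finB: "B b < \<top>" for b
  proof (rule ccontr)
    assume "\<not> B b < \<top>"
    then have "A a0 * B b ^ k = \<top>"
      using a0 k by (simp add: less_top[symmetric] ennreal_mult_top power_top_ennreal)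
    then show False using AB1[of a0 b] nle by simp
  qed
  define a where "a x = enn2real (A x)" for x
  define b where "b x = enn2real (B x)" for x
  have Aa: "A x = ennreal (a x)" and Bb: "B x = ennreal (b x)" for x
    using finA finB by (simp_all add: a_def b_def)
  have nn: "a x \<ge> 0" "b x \<ge> 0" for x by (simp_all add: a_def b_def)
  have [measurable]: "a \<in> borel_measurable borel" "b \<in> borel_measurable borel"
    unfolding a_def b_def by measurable
  have ab: "a x * b y ^ k \<le> p (1 / (real k + 1) * x + real k / (real k + 1) * y) ^ Suc k" for x y
    using AB[of x y] nn p0 by (simp add: Aa Bb ennreal_power ennreal_mult[symmetric] del: power_Suc)
  have ab1: "a x * b y ^ k \<le> 1" for x y
    using AB1[of x y] nn by (simp add: Aa Bb ennreal_power ennreal_mult[symmetric])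
  have a0': "a a0 > 0" and b0': "b b0 > 0"
    using a0 b0 nn[of a0] nn[of b0] by (auto simp: Aa Bb less_le)
  have "a x \<le> 1 / b b0 ^ k" for x
    using ab1[of x b0] b0' by (simp add: field_simps)
  then have bdda: "bdd_above (range a)" by (auto simp: bdd_above_def)
  \<comment> \<open>The hypothesis controls only \<open>b x ^ k\<close>; above height 1 this
    dominates \<open>b x\<close>.\<close>
  have "b x \<le> 1 + 1 / a a0" for x
  proof (cases "b x \<le> 1")
    case True then show ?thesis using a0' by (simp add: add_increasing2)
  next
    case False
    then have "b x \<le> b x ^ k" using k by (intro self_le_power) auto
    also have "\<dots> \<le> 1 / a a0" using ab1[of a0 x] a0' by (simp add: field_simps)
    finally show ?thesis by simp
  qed
  then have bddb: "bdd_above (range b)" by (auto simp: bdd_above_def)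
  define \<alpha> where "\<alpha> = Sup (range a)"
  define \<beta> where "\<beta> = Sup (range b)"
  have ale: "a x \<le> \<alpha>" and ble: "b x \<le> \<beta>" for x
    unfolding \<alpha>_def \<beta>_def using bdda bddb by (auto intro: cSup_upper)
  have pos: "\<alpha> > 0" "\<beta> > 0" using a0' b0' ale[of a0] ble[of b0] by auto
  \<comment> \<open>The weighted geometric mean of \<open>\<alpha>\<close> and
    \<open>\<beta>\<close>: the scale by which \<open>p\<close> must be divided once
    \<open>a\<close> and \<open>b\<close> are divided by their suprema.\<close>
  define \<rho> where "\<rho> = root (Suc k) (\<alpha> * \<beta> ^ k)"
  have \<rho>: "\<rho> > 0" "\<rho> ^ Suc k = \<alpha> * \<beta> ^ k"
    using pos by (auto simp: \<rho>_def intro!: real_root_pow_pos simp del: power_Suc)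
  define t where "t = 1 / (real k + 1)"
  define s where "s = real k / (real k + 1)"
  have ts: "t > 0" "s > 0" using k by (auto simp: t_def s_def)
  have main: "ennreal t * (\<integral>\<^sup>+x. a x / \<alpha> \<partial>lborel) + ennreal s * (\<integral>\<^sup>+x. b x / \<beta> \<partial>lborel)
      \<le> (\<integral>\<^sup>+x. p x / \<rho> \<partial>lborel)"
  proof (rule prekopa_leindler_real_normalised[OF _ _ _ _ _ _ _ ts])
    show "a x / \<alpha> \<le> 1" "b x / \<beta> \<le> 1" for x using ale ble pos by auto
    show "\<exists>x. u < a x / \<alpha>" if "u < 1" for u
    proof -
      have "u * \<alpha> < \<alpha>" using that pos by simp
      then have "\<exists>y\<in>range a. u * \<alpha> < y"
        unfolding \<alpha>_def using less_cSup_iff[of "range a"] bdda by blast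
      then obtain x where "u * \<alpha> < a x" by auto
      then show ?thesis using pos by (auto simp: field_simps)
    qed
    show "\<exists>x. u < b x / \<beta>" if "u < 1" for u
    proof -
      have "u * \<beta> < \<beta>" using that pos by simp
      then have "\<exists>y\<in>range b. u * \<beta> < y"
        unfolding \<beta>_def using less_cSup_iff[of "range b"] bddb by blast
      then obtain x where "u * \<beta> < b x" by auto
      then show ?thesis using pos by (auto simp: field_simps)
    qed
    fix u x y :: real assume u: "0 < u" "u < a x / \<alpha>" "u < b y / \<beta>"
    \<comment> \<open>One factor \<open>u\<close> is compared with \<open>a x / \<alpha>\<close> and
      the other \<open>k\<close> factors with \<open>b y / \<beta>\<close>; comparing bases of equal
      powers recovers \<open>u\<close> at the end.\<close>
    have "u ^ Suc k = u * u ^ k" by simp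
    also have "\<dots> < (a x / \<alpha>) * (b y / \<beta>) ^ k"
      using u k by (intro mult_strict_mono power_strict_mono) auto
    also have "\<dots> = a x * b y ^ k / \<rho> ^ Suc k"
      unfolding \<rho> by (simp add: power_divide)
    also have "\<dots> \<le> p (t * x + s * y) ^ Suc k / \<rho> ^ Suc k"
      using ab[of x y] \<rho>(1) by (intro divide_right_mono) (auto simp: t_def s_def)
    also have "\<dots> = (p (t * x + s * y) / \<rho>) ^ Suc k"
      by (simp only: power_divide)
    finally show "u < p (t * x + s * y) / \<rho>"
      by (rule power_less_imp_less_base) (use p0 \<rho> in auto)
  qed auto
  have scale: "(\<integral>\<^sup>+x. ennreal (F x / c) \<partial>lborel) = (\<integral>\<^sup>+x. ennreal (F x) \<partial>lborel) / ennreal c"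
    if "c > 0" "\<And>x. F x \<ge> 0" "F \<in> borel_measurable borel" for F c
    using that by (simp add: divide_ennreal[symmetric] nn_integral_divide)
  have rhs: "(\<integral>\<^sup>+x. p x / \<rho> \<partial>lborel) = ennreal (1 / \<rho>)"
    using \<rho>(1) p0 by (subst scale) (auto simp: int_p divide_ennreal[symmetric])
  define IA where "IA = (\<integral>\<^sup>+x. a x / \<alpha> \<partial>lborel)"
  define IB where "IB = (\<integral>\<^sup>+x. b x / \<beta> \<partial>lborel)"
  have le: "ennreal t * IA + ennreal s * IB \<le> ennreal (1 / \<rho>)"
    using main rhs by (simp add: IA_def IB_def)
  then have "ennreal t * IA + ennreal s * IB < \<top>" by (rule le_less_trans) simp
  then have fin: "IA < \<top>" "IB < \<top>" using ts by (auto simp: less_top[symmetric] ennreal_mult_eq_top_iff)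
  define ia where "ia = enn2real IA"
  define ib where "ib = enn2real IB"
  have I: "IA = ennreal ia" "IB = ennreal ib" "ia \<ge> 0" "ib \<ge> 0"
    using fin by (auto simp: ia_def ib_def)
  have real_le: "t * ia + s * ib \<le> 1 / \<rho>"
    using le I ts \<rho>(1) by (simp add: ennreal_mult[symmetric] ennreal_plus[symmetric] del: ennreal_plus)
  \<comment> \<open>AM-GM returns from the arithmetic mean to the product; the factor
    \<open>1 / \<rho> ^ Suc k\<close> then cancels the suprema.\<close>
  have "ia * ib ^ k \<le> ((ia + real k * ib) / (real k + 1)) ^ Suc k"
    using I k by (intro weighted_arith_geo_mean) auto
  also have "(ia + real k * ib) / (real k + 1) = t * ia + s * ib"
    by (simp add: t_def s_def add_divide_distrib)
  also have "(t * ia + s * ib) ^ Suc k \<le> (1 / \<rho>) ^ Suc k"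
    using real_le I ts by (intro power_mono) auto
  also have "\<dots> = 1 / (\<alpha> * \<beta> ^ k)" by (simp only: power_one_over \<rho>)
  finally have "(\<alpha> * ia) * (\<beta> * ib) ^ k \<le> 1"
    using pos by (simp add: field_simps power_mult_distrib)
  moreover have "(\<integral>\<^sup>+x. A x \<partial>lborel) = ennreal (\<alpha> * ia)"
  proof -
    have "(\<integral>\<^sup>+x. A x \<partial>lborel) = (\<integral>\<^sup>+x. ennreal \<alpha> * ennreal (a x / \<alpha>) \<partial>lborel)"
      using pos nn by (intro nn_integral_cong) (simp add: Aa ennreal_mult[symmetric])
    also have "\<dots> = ennreal \<alpha> * IA" unfolding IA_def by (rule nn_integral_cmult) simp
    finally show ?thesis using I pos by (simp add: ennreal_mult)
  qed
  moreover have "(\<integral>\<^sup>+x. B x \<partial>lborel) = ennreal (\<beta> * ib)"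
  proof -
    have "(\<integral>\<^sup>+x. B x \<partial>lborel) = (\<integral>\<^sup>+x. ennreal \<beta> * ennreal (b x / \<beta>) \<partial>lborel)"
      using pos nn by (intro nn_integral_cong) (simp add: Bb ennreal_mult[symmetric])
    also have "\<dots> = ennreal \<beta> * IB" unfolding IB_def by (rule nn_integral_cmult) simp
    finally show ?thesis using I pos by (simp add: ennreal_mult)
  qed
  ultimately show ?thesis
    using pos I by (simp add: ennreal_power ennreal_mult[symmetric])
qed

subsection \<open>Tensorisation\<close>

text \<open>This is the Prekopa--Leindler inequality relative to \<open>\<mu>\<close> with weights \<open>1 / (k + 1)\<close> and
  \<open>k / (k + 1)\<close>, raised to the power \<open>k + 1\<close>: only natural powers of \<open>E\<close> and \<open>D\<close> remain, which
  make sense for \<^typ>\<open>ennreal\<close>-valued functions without integrability assumptions.\<close>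

definition pl_ineq :: "nat \<Rightarrow> 'a measure \<Rightarrow> ('a \<Rightarrow> 'a \<Rightarrow> real) \<Rightarrow> bool" where
  "pl_ineq k \<mu> c \<longleftrightarrow> (\<forall>E \<in> borel_measurable \<mu>. \<forall>D \<in> borel_measurable \<mu>.
     (\<forall>a \<in> space \<mu>. \<forall>b \<in> space \<mu>. E a * D b ^ k \<le> ennreal (exp (c a b))) \<longrightarrow>
     (\<integral>\<^sup>+a. E a \<partial>\<mu>) * (\<integral>\<^sup>+b. D b \<partial>\<mu>) ^ k \<le> 1)"

lemma pl_ineqI:
  assumes "\<And>E D. E \<in> borel_measurable \<mu> \<Longrightarrow> D \<in> borel_measurable \<mu> \<Longrightarrow>
     (\<And>a b. a \<in> space \<mu> \<Longrightarrow> b \<in> space \<mu> \<Longrightarrow> E a * D b ^ k \<le> ennreal (exp (c a b))) \<Longrightarrow>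
     (\<integral>\<^sup>+a. E a \<partial>\<mu>) * (\<integral>\<^sup>+b. D b \<partial>\<mu>) ^ k \<le> 1"
  shows "pl_ineq k \<mu> c"
  using assms unfolding pl_ineq_def by blast

lemma pl_ineqD:
  assumes "pl_ineq k \<mu> c" "E \<in> borel_measurable \<mu>" "D \<in> borel_measurable \<mu>"
    and "\<And>a b. a \<in> space \<mu> \<Longrightarrow> b \<in> space \<mu> \<Longrightarrow> E a * D b ^ k \<le> ennreal (exp (c a b))"
  shows "(\<integral>\<^sup>+a. E a \<partial>\<mu>) * (\<integral>\<^sup>+b. D b \<partial>\<mu>) ^ k \<le> 1"
  using assms unfolding pl_ineq_def by blast

lemma ennreal_mult_exp_cancel: "ennreal (exp x) * ennreal (exp (- x)) = 1"
  by (simp add: ennreal_mult[symmetric] exp_minus)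

text \<open>Multiplying \<open>E\<close> by \<open>exp (- r)\<close> absorbs the constant. In the
  tensorisation, \<open>r\<close> is the cost of the coordinates held fixed.\<close>

lemma pl_ineqD_shift:
  assumes "pl_ineq k \<mu> c" and [measurable]: "E \<in> borel_measurable \<mu>" "D \<in> borel_measurable \<mu>"
    and le: "\<And>a b. a \<in> space \<mu> \<Longrightarrow> b \<in> space \<mu> \<Longrightarrow> E a * D b ^ k \<le> ennreal (exp (r + c a b))"
  shows "(\<integral>\<^sup>+a. E a \<partial>\<mu>) * (\<integral>\<^sup>+b. D b \<partial>\<mu>) ^ k \<le> ennreal (exp r)"
proof -
  have "(\<integral>\<^sup>+a. ennreal (exp (- r)) * E a \<partial>\<mu>) * (\<integral>\<^sup>+b. D b \<partial>\<mu>) ^ k \<le> 1"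
  proof (rule pl_ineqD[OF assms(1)])
    fix a b assume ab: "a \<in> space \<mu>" "b \<in> space \<mu>"
    have "ennreal (exp (- r)) * E a * D b ^ k \<le> ennreal (exp (- r)) * ennreal (exp (r + c a b))"
      using le[OF ab] by (simp add: mult.assoc mult_left_mono)
    also have "\<dots> = ennreal (exp (c a b))"
      by (simp add: ennreal_mult[symmetric] exp_add[symmetric])
    finally show "ennreal (exp (- r)) * E a * D b ^ k \<le> ennreal (exp (c a b))" .
  qed measurable
  then have "ennreal (exp r) * (ennreal (exp (- r)) * ((\<integral>\<^sup>+a. E a \<partial>\<mu>) * (\<integral>\<^sup>+b. D b \<partial>\<mu>) ^ k))
     \<le> ennreal (exp r) * 1"
    by (intro mult_left_mono) (simp_all add: nn_integral_cmult mult.assoc)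
  then show ?thesis
    by (simp add: mult.assoc[symmetric] ennreal_mult_exp_cancel)
qed

text \<open>Induction on the coordinates. With the others fixed, the inequality for
  \<open>M i\<close> bounds the partial integrals over coordinate \<open>i\<close> by the
  exponential of the remaining cost. This is exactly the hypothesis needed to apply the induction
  hypothesis to those partial integrals, and Tonelli's theorem reassembles the full
  integrals.\<close>

lemma pl_ineq_PiM:
  assumes sf: "product_sigma_finite M" and "finite I"
    and pl: "\<And>i. i \<in> I \<Longrightarrow> pl_ineq k (M i) (c i)"
  shows "pl_ineq k (PiM I M) (\<lambda>x y. \<Sum>i\<in>I. c i (x i) (y i))"
  using assms(2,3)
proof (induction I)
  case empty
  interpret product_sigma_finite M by (rule sf)
  show ?case
    by (rule pl_ineqI) (simp add: PiM_empty nn_integral_count_space_finite)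
next
  case (insert i I)
  interpret product_sigma_finite M by (rule sf)
  interpret I: finite_product_sigma_finite M I by standard fact
  interpret Mi: sigma_finite_measure "M i" by (rule sigma_finite_measures)
  have IH: "pl_ineq k (PiM I M) (\<lambda>x y. \<Sum>i\<in>I. c i (x i) (y i))"
    using insert by auto
  show ?case
  proof (rule pl_ineqI)
    fix E D :: "('a \<Rightarrow> 'b) \<Rightarrow> ennreal"
    assume m[measurable]: "E \<in> borel_measurable (PiM (insert i I) M)"
       "D \<in> borel_measurable (PiM (insert i I) M)"
    assume le: "E a * D b ^ k \<le> ennreal (exp (\<Sum>j\<in>insert i I. c j (a j) (b j)))"
      if "a \<in> space (PiM (insert i I) M)" "b \<in> space (PiM (insert i I) M)" for a b
    have upd: "x(i := y) \<in> space (PiM (insert i I) M)"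
      if "x \<in> space (PiM I M)" "y \<in> space (M i)" for x y
      using that by (auto simp: space_PiM PiE_def extensional_def Pi_def)
    have "(\<integral>\<^sup>+x. (\<integral>\<^sup>+y. E (x(i := y)) \<partial>M i) \<partial>PiM I M) * (\<integral>\<^sup>+x. (\<integral>\<^sup>+y. D (x(i := y)) \<partial>M i) \<partial>PiM I M) ^ k \<le> 1"
    proof (rule pl_ineqD[OF IH])
      fix x x' assume x: "x \<in> space (PiM I M)" "x' \<in> space (PiM I M)"
      have [measurable]: "(\<lambda>y. F (z(i := y))) \<in> borel_measurable (M i)"
        if "F \<in> borel_measurable (PiM (insert i I) M)" "z \<in> space (PiM I M)" for z and F :: "('a \<Rightarrow> 'b) \<Rightarrow> ennreal"
        using measurable_comp[OF measurable_component_update[OF that(2) insert.hyps(2)] that(1)]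
        unfolding comp_def .
      show "(\<integral>\<^sup>+y. E (x(i := y)) \<partial>M i) * (\<integral>\<^sup>+y. D (x'(i := y)) \<partial>M i) ^ k
         \<le> ennreal (exp (\<Sum>j\<in>I. c j (x j) (x' j)))"
      proof (rule pl_ineqD_shift)
        show "pl_ineq k (M i) (c i)" using insert by auto
        fix y y' assume y: "y \<in> space (M i)" "y' \<in> space (M i)"
        have "(\<Sum>j\<in>insert i I. c j ((x(i := y)) j) ((x'(i := y')) j))
           = c i y y' + (\<Sum>j\<in>I. c j ((x(i := y)) j) ((x'(i := y')) j))"
          using insert.hyps by simp
        also have "(\<Sum>j\<in>I. c j ((x(i := y)) j) ((x'(i := y')) j)) = (\<Sum>j\<in>I. c j (x j) (x' j))"
          using insert.hyps by (intro sum.cong) auto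
        finally show "E (x(i := y)) * D (x'(i := y')) ^ k
            \<le> ennreal (exp ((\<Sum>j\<in>I. c j (x j) (x' j)) + c i y y'))"
          using le[OF upd upd, OF x(1) y(1) x(2) y(2)] by (simp add: add.commute)
      qed (use x in measurable)
    qed measurable
    then show "integral\<^sup>N (PiM (insert i I) M) E * integral\<^sup>N (PiM (insert i I) M) D ^ k \<le> 1"
      using insert.hyps by (simp add: product_nn_integral_insert)
  qed
qed

text \<open>Change of variables; the costs only have to agree along \<open>T\<close>. This carries
  the inequality from coordinates to vectors.\<close>

lemma pl_ineq_distr:
  assumes "pl_ineq k \<mu> c" and [measurable]: "T \<in> measurable \<mu> \<nu>"
    and cost: "\<And>a b. a \<in> space \<mu> \<Longrightarrow> b \<in> space \<mu> \<Longrightarrow> c' (T a) (T b) = c a b"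
  shows "pl_ineq k (distr \<mu> \<nu> T) c'"
proof (rule pl_ineqI)
  fix E D :: "'b \<Rightarrow> ennreal"
  assume [measurable]: "E \<in> borel_measurable (distr \<mu> \<nu> T)" "D \<in> borel_measurable (distr \<mu> \<nu> T)"
  assume le: "E a * D b ^ k \<le> ennreal (exp (c' a b))"
    if "a \<in> space (distr \<mu> \<nu> T)" "b \<in> space (distr \<mu> \<nu> T)" for a b
  have "(\<integral>\<^sup>+a. E (T a) \<partial>\<mu>) * (\<integral>\<^sup>+b. D (T b) \<partial>\<mu>) ^ k \<le> 1"
  proof (rule pl_ineqD[OF assms(1)])
    fix a b assume "a \<in> space \<mu>" "b \<in> space \<mu>"
    then show "E (T a) * D (T b) ^ k \<le> ennreal (exp (c a b))"
      using le[of "T a" "T b"] cost measurable_space[OF assms(2)] by simp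
  qed measurable
  then show "integral\<^sup>N (distr \<mu> \<nu> T) E * integral\<^sup>N (distr \<mu> \<nu> T) D ^ k \<le> 1"
    by (simp add: nn_integral_distr)
qed

section \<open>The one-dimensional standard normal distribution\<close>

lemma std_normal_density_le_1: "std_normal_density x \<le> 1"
proof -
  have "1 \<le> sqrt (2 * pi)" using pi_ge_two by (intro real_le_rsqrt) auto
  moreover have "exp (- x\<^sup>2 / 2) \<le> 1" by simp
  ultimately show ?thesis unfolding std_normal_density_def
    by (intro mult_le_one) auto
qed

text \<open>The exponents match by the variance identity
  \<open>a^2 + k * b^2 - (k + 1) * z^2 = k / (k + 1) * (a - b)^2\<close> for the weighted mean
  \<open>z\<close>. It is the source of the quadratic cost.\<close>

lemma std_normal_density_convexity:
  assumes "k \<ge> 1"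
  shows "std_normal_density a * std_normal_density b ^ k * exp (real k / (real k + 1) * ((a - b)\<^sup>2 / 2))
     = std_normal_density (1 / (real k + 1) * a + real k / (real k + 1) * b) ^ Suc k"
proof -
  define z where "z = 1 / (real k + 1) * a + real k / (real k + 1) * b"
  have p: "real k + 1 > 0" by simp
  have "z = (a + real k * b) / (real k + 1)" by (simp add: z_def add_divide_distrib)
  then have "(real k + 1) * z = a + real k * b" using p by simp
  then have z2: "(real k + 1)\<^sup>2 * z\<^sup>2 = (a + real k * b)\<^sup>2" by (metis power_mult_distrib)
  have "(real k + 1) * (- a\<^sup>2 / 2 + real k * (- b\<^sup>2 / 2) + real k / (real k + 1) * ((a - b)\<^sup>2 / 2))
     = (real k + 1) * (- a\<^sup>2 / 2 + real k * (- b\<^sup>2 / 2)) + real k * ((a - b)\<^sup>2 / 2)"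
  proof -
    have "(real k + 1) * (real k / (real k + 1) * q) = real k * q" for q using p by simp
    then show ?thesis by (simp only: distrib_left)
  qed
  also have "\<dots> = - (a + real k * b)\<^sup>2 / 2"
    by (simp add: power2_eq_square algebra_simps add_divide_distrib diff_divide_distrib)
  also have "\<dots> = (real k + 1) * ((real k + 1) * (- z\<^sup>2 / 2))"
    using z2 by (simp add: power2_eq_square)
  finally have "- a\<^sup>2 / 2 + real k * (- b\<^sup>2 / 2) + real k / (real k + 1) * ((a - b)\<^sup>2 / 2)
     = (real k + 1) * (- z\<^sup>2 / 2)" using p by (subst (asm) mult_cancel_left) simp
  then have e: "exp (- a\<^sup>2 / 2) * exp (- b\<^sup>2 / 2) ^ k * exp (real k / (real k + 1) * ((a - b)\<^sup>2 / 2))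
     = exp (- z\<^sup>2 / 2) ^ Suc k"
    by (simp add: exp_of_nat_mult[symmetric] exp_add[symmetric] algebra_simps del: power_Suc)
  show ?thesis unfolding z_def[symmetric] std_normal_density_def power_mult_distrib e[symmetric]
    by (simp add: algebra_simps)
qed

lemma prob_space_std_normal: "prob_space (density lborel (\<lambda>x. ennreal (std_normal_density x)))"
  by (rule prob_space_normal_density) simp

text \<open>Prekopa--Leindler on the line for \<open>E\<close> and \<open>D\<close> multiplied by
  the normal density: by the convexity identity, the two densities and the cost combine exactly into
  the density at the weighted mean.\<close>

lemma pl_ineq_std_normal:
  assumes k: "k \<ge> 1"
  shows "pl_ineq k (density lborel (\<lambda>x. ennreal (std_normal_density x)))
           (\<lambda>a b. real k / (real k + 1) * ((a - b)\<^sup>2 / 2))"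
proof (rule pl_ineqI)
  let ?N = "density lborel (\<lambda>x. ennreal (std_normal_density x))"
  fix E D :: "real \<Rightarrow> ennreal"
  assume "E \<in> borel_measurable ?N" "D \<in> borel_measurable ?N"
  then have [measurable]: "E \<in> borel_measurable borel" "D \<in> borel_measurable borel" by simp_all
  assume le: "E a * D b ^ k \<le> ennreal (exp (real k / (real k + 1) * ((a - b)\<^sup>2 / 2)))"
    if "a \<in> space ?N" "b \<in> space ?N" for a b
  let ?\<phi> = "\<lambda>x. ennreal (std_normal_density x)"
  have "(\<integral>\<^sup>+x. ?\<phi> x * E x \<partial>lborel) * (\<integral>\<^sup>+x. ?\<phi> x * D x \<partial>lborel) ^ k \<le> 1"
  proof (rule prekopa_leindler_real[OF k, where p = std_normal_density])
    interpret prob_space ?N by (rule prob_space_std_normal)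
    show "(\<integral>\<^sup>+x. ?\<phi> x \<partial>lborel) = 1"
      using emeasure_space_1 by (simp add: emeasure_density)
    fix a b
    have "(?\<phi> a * E a) * (?\<phi> b * D b) ^ k = (?\<phi> a * ?\<phi> b ^ k) * (E a * D b ^ k)"
      by (simp add: power_mult_distrib algebra_simps)
    also have "\<dots> \<le> (?\<phi> a * ?\<phi> b ^ k) * ennreal (exp (real k / (real k + 1) * ((a - b)\<^sup>2 / 2)))"
      using le[of a b] by (intro mult_left_mono) auto
    also have "\<dots> = ennreal (std_normal_density (1 / (real k + 1) * a + real k / (real k + 1) * b) ^ Suc k)"
      by (subst std_normal_density_convexity[OF k, symmetric]) (simp add: ennreal_power ennreal_mult)
    finally show "(?\<phi> a * E a) * (?\<phi> b * D b) ^ k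
      \<le> ennreal (std_normal_density (1 / (real k + 1) * a + real k / (real k + 1) * b) ^ Suc k)" .
  qed (auto simp: std_normal_density_le_1)
  then show "integral\<^sup>N ?N E * integral\<^sup>N ?N D ^ k \<le> 1"
    by (simp add: nn_integral_density)
qed

subsection \<open>Gaussian concentration\<close>

lemma PiM_density:
  assumes "product_sigma_finite M" and psf: "product_sigma_finite (\<lambda>i. density (M i) (f i))"
    and fin: "finite I" and meas: "\<And>i. i \<in> I \<Longrightarrow> f i \<in> borel_measurable (M i)"
  shows "PiM I (\<lambda>i. density (M i) (f i)) = density (PiM I M) (\<lambda>x. \<Prod>i\<in>I. f i (x i))"
\<comment> \<open>A measure on a finite product is determined by its values on boxes, where the
  integral factorises.\<close>
proof (rule product_sigma_finite.PiM_eqI[OF psf fin, symmetric])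
  interpret product_sigma_finite M by fact
  note meas[measurable]
  show "sets (density (PiM I M) (\<lambda>x. \<Prod>i\<in>I. f i (x i))) = sets (PiM I (\<lambda>i. density (M i) (f i)))"
    by (simp cong: sets_PiM_cong)
  fix A assume "\<And>i. i \<in> I \<Longrightarrow> A i \<in> sets (density (M i) (f i))"
  then have A[measurable]: "i \<in> I \<Longrightarrow> A i \<in> sets (M i)" for i by simp
  have [measurable]: "(\<lambda>x. \<Prod>i\<in>I. f i (x i)) \<in> borel_measurable (PiM I M)"
    by (intro borel_measurable_prod_ennreal) measurable
  have "emeasure (density (PiM I M) (\<lambda>x. \<Prod>i\<in>I. f i (x i))) (Pi\<^sub>E I A)
      = (\<integral>\<^sup>+x. (\<Prod>i\<in>I. f i (x i)) * indicator (Pi\<^sub>E I A) x \<partial>PiM I M)"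
    using fin A by (intro emeasure_density sets_PiM_I_finite) auto
  also have "\<dots> = (\<integral>\<^sup>+x. (\<Prod>i\<in>I. f i (x i) * indicator (A i) (x i)) \<partial>PiM I M)"
  proof (rule nn_integral_cong)
    fix x assume x: "x \<in> space (PiM I M)"
    have "(indicator (Pi\<^sub>E I A) x :: ennreal) = (\<Prod>i\<in>I. indicator (A i) (x i))"
    proof (cases "x \<in> Pi\<^sub>E I A")
      case True
      then show ?thesis by (auto simp: PiE_mem intro!: prod.neutral[symmetric])
    next
      \<comment> \<open>Points of the product space are extensional, so a point outside the box
        misses some \<open>A i\<close>, and that factor is 0.\<close>
      case False
      with x obtain i where "i \<in> I" "x i \<notin> A i" by (auto simp: space_PiM PiE_iff)
      then show ?thesis using False fin by (auto intro!: prod_zero[symmetric] bexI[of _ i])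
    qed
    then show "(\<Prod>i\<in>I. f i (x i)) * indicator (Pi\<^sub>E I A) x
       = (\<Prod>i\<in>I. f i (x i) * indicator (A i) (x i))"
      by (simp add: prod.distrib)
  qed
  also have "\<dots> = (\<Prod>i\<in>I. \<integral>\<^sup>+y. f i y * indicator (A i) y \<partial>M i)"
    using fin by (intro product_nn_integral_prod) measurable
  also have "\<dots> = (\<Prod>i\<in>I. emeasure (density (M i) (f i)) (A i))"
    by (intro prod.cong refl emeasure_density[symmetric]) auto
  finally show "emeasure (density (PiM I M) (\<lambda>x. \<Prod>i\<in>I. f i (x i))) (Pi\<^sub>E I A)
     = (\<Prod>i\<in>I. emeasure (density (M i) (f i)) (A i))" .
qed

text \<open>The coordinates are re-indexed because \<open>lborel_eq\<close> presents Lebesgue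
  measure as the image of a product over \<open>Basis\<close>.\<close>

lemma std_gaussian_density_Basis:
  fixes z :: "real ^ 'n"
  shows "std_gaussian_density z = (\<Prod>b\<in>Basis. std_normal_density (z \<bullet> b))"
proof -
  have B: "(Basis :: (real ^ 'n) set) = range (\<lambda>i. axis i 1)"
    by (auto simp: Basis_vec_def)
  have "inj (\<lambda>i. axis i (1::real) :: real ^ 'n)" by (auto simp: inj_def axis_eq_axis)
  then show ?thesis
    unfolding B std_gaussian_density_def by (simp add: prod.reindex inner_axis)
qed

abbreviation std_gaussian :: "(real ^ 'n) measure" where
  "std_gaussian \<equiv> density lborel (\<lambda>z. ennreal (std_gaussian_density z))"

lemma std_gaussian_density_measurable[measurable]:
  "std_gaussian_density \<in> borel_measurable borel"
  unfolding std_gaussian_density_def[abs_def] by measurable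

text \<open>Lebesgue measure and the density both factorise over the coordinates, and densities can
  be pulled back along the map that forms the image.\<close>

lemma std_gaussian_eq_distr:
  "(std_gaussian :: (real ^ 'n) measure)
    = distr (PiM Basis (\<lambda>_. density lborel (\<lambda>x. ennreal (std_normal_density x)))) borel
        (\<lambda>f. \<Sum>b\<in>Basis. f b *\<^sub>R b)"
proof -
  let ?N = "density lborel (\<lambda>x. ennreal (std_normal_density x))"
  let ?T = "\<lambda>f. (\<Sum>b\<in>Basis. f b *\<^sub>R b) :: real ^ 'n"
  interpret N: prob_space ?N by (rule prob_space_std_normal)
  have eq: "PiM Basis (\<lambda>_::real ^ 'n. ?N)
      = density (PiM Basis (\<lambda>_. lborel)) (\<lambda>x. \<Prod>b\<in>Basis. ennreal (std_normal_density (x b)))"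
    by (rule PiM_density)
       (auto simp: product_sigma_finite_def sigma_finite_lborel N.sigma_finite_measure)
  have [measurable]: "?T \<in> measurable (PiM Basis (\<lambda>_. lborel)) borel"
    by measurable
  have "(std_gaussian :: (real ^ 'n) measure)
      = density (distr (PiM Basis (\<lambda>_. lborel)) borel ?T) (\<lambda>z. ennreal (std_gaussian_density z))"
    by (subst lborel_eq) simp
  also have "\<dots> = distr (density (PiM Basis (\<lambda>_. lborel)) (\<lambda>f. ennreal (std_gaussian_density (?T f)))) borel ?T"
    by (rule density_distr) measurable
  also have "(\<lambda>f. ennreal (std_gaussian_density (?T f)))
      = (\<lambda>x. \<Prod>b\<in>Basis. ennreal (std_normal_density (x b)))"
    by (auto simp: fun_eq_iff std_gaussian_density_Basis prod_ennreal inner_sum_left_Basis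
          intro!: arg_cong[where f = ennreal] prod.cong)
  finally show ?thesis unfolding eq .
qed

text \<open>By Pythagoras, the squared distance is the sum of the squared coordinate differences, so
  the one-dimensional costs add up to the cost claimed here.\<close>

lemma pl_ineq_std_gaussian:
  assumes k: "k \<ge> 1"
  shows "pl_ineq k (std_gaussian :: (real ^ 'n) measure)
           (\<lambda>a b. real k / (real k + 1) * ((norm (a - b))\<^sup>2 / 2))"
  unfolding std_gaussian_eq_distr
proof (rule pl_ineq_distr[OF pl_ineq_PiM[OF _ _ pl_ineq_std_normal[OF k]]])
  let ?N = "density lborel (\<lambda>x. ennreal (std_normal_density x))"
  interpret N: prob_space ?N by (rule prob_space_std_normal)
  show "product_sigma_finite (\<lambda>_::real ^ 'n. ?N)"
    by (simp add: product_sigma_finite_def N.sigma_finite_measure)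
  fix x y :: "real ^ 'n \<Rightarrow> real"
  have "(norm ((\<Sum>b\<in>Basis. x b *\<^sub>R b) - (\<Sum>b\<in>Basis. y b *\<^sub>R b) :: real ^ 'n))\<^sup>2
      = (\<Sum>b\<in>Basis. (x b - y b)\<^sup>2)"
    unfolding power2_norm_eq_inner
    by (subst euclidean_inner) (simp add: inner_diff_left inner_sum_left_Basis power2_eq_square)
  then show "real k / (real k + 1)
      * ((norm ((\<Sum>b\<in>Basis. x b *\<^sub>R b) - (\<Sum>b\<in>Basis. y b *\<^sub>R b) :: real ^ 'n))\<^sup>2 / 2)
      = (\<Sum>b\<in>Basis. real k / (real k + 1) * ((x b - y b)\<^sup>2 / 2))"
    by (simp add: sum_distrib_left sum_divide_distrib)
qed auto

section \<open>Jensen's inequality and exponential moments of Lipschitz functions\<close>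

lemma (in prob_space) exp_integral_le_nn_integral_exp:
  assumes "integrable M X"
  shows "ennreal (exp (expectation X)) \<le> (\<integral>\<^sup>+x. ennreal (exp (X x)) \<partial>M)"
proof (cases "integrable M (\<lambda>x. exp (X x))")
  case True
  \<comment> \<open>The integrand on the right is the tangent line of \<open>exp\<close> at the mean
    of \<open>X\<close>, evaluated at \<open>X x\<close>; it lies below
    \<open>exp (X x)\<close>.\<close>
  have "exp (expectation X) = expectation (\<lambda>x. exp (expectation X) * (1 + (X x - expectation X)))"
    using assms by (simp add: prob_space)
  also have "\<dots> \<le> expectation (\<lambda>x. exp (X x))"
  proof (rule integral_mono[OF _ True])
    fix x
    have "exp (expectation X) * (1 + (X x - expectation X))
        \<le> exp (expectation X) * exp (X x - expectation X)"
      by (intro mult_left_mono exp_ge_add_one_self) auto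
    then show "exp (expectation X) * (1 + (X x - expectation X)) \<le> exp (X x)"
      by (simp add: exp_add[symmetric])
  qed (use assms in auto)
  finally show ?thesis using True
    by (subst nn_integral_eq_integral) (auto intro: ennreal_leI)
next
  \<comment> \<open>If \<open>exp X\<close> is not integrable, the integral on the right is
    infinite.\<close>
  case False
  have "X \<in> borel_measurable M" using assms by auto
  then have "(\<lambda>x. exp (X x)) \<in> borel_measurable M" by measurable
  with False have "(\<integral>\<^sup>+x. ennreal (exp (X x)) \<partial>M) = \<top>"
    by (simp add: integrable_iff_bounded less_top[symmetric])
  then show ?thesis by simp
qed

text \<open>\<open>q\<close> stands for a squared distance, later the squared Euclidean distance of
  the whole noise. The inequality is demanded for every \<open>k\<close> because the sharp constant
  appears only as \<open>k\<close> tends to infinity.\<close>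

locale gaussian_pl = prob_space \<mu> for \<mu> :: "'a measure" +
  fixes q :: "'a \<Rightarrow> 'a \<Rightarrow> real"
  assumes q_nonneg: "\<And>a b. q a b \<ge> 0"
    and pl: "\<And>k. k \<ge> 1 \<Longrightarrow> pl_ineq k \<mu> (\<lambda>a b. real k / (real k + 1) * (q a b / 2))"
begin

context
  fixes h :: "'a \<Rightarrow> real" and \<sigma> :: real
  assumes h[measurable]: "h \<in> borel_measurable \<mu>"
    and lip: "\<And>a b. a \<in> space \<mu> \<Longrightarrow> b \<in> space \<mu> \<Longrightarrow> \<bar>h a - h b\<bar> \<le> \<sigma> * sqrt (q a b)"
begin

text \<open>Young's inequality splits \<open>\<sigma> * sqrt (q a b)\<close> into the cost allowed
  by the inequality and a constant. The sign \<open>e\<close> covers \<open>h\<close> and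
  \<open>- h\<close> at once.\<close>

lemma pl_exp:
  assumes "k \<ge> 1" "e = 1 \<or> e = -1"
  shows "(\<integral>\<^sup>+a. ennreal (exp (e * h a)) \<partial>\<mu>) * (\<integral>\<^sup>+a. ennreal (exp (- e * h a / real k)) \<partial>\<mu>) ^ k
    \<le> ennreal (exp (\<sigma>\<^sup>2 / 2 * (1 + 1 / real k)))"
proof (rule pl_ineqD_shift[OF pl[OF assms(1)]])
  fix a b assume ab: "a \<in> space \<mu>" "b \<in> space \<mu>"
  have k: "real k > 0" using assms by simp
  have "e * h a - e * h b \<le> \<bar>h a - h b\<bar>" using assms by auto
  also have "\<dots> \<le> \<sigma> * sqrt (q a b)" by (rule lip[OF ab])
  also have "\<dots> \<le> \<sigma>\<^sup>2 / 2 * (1 + 1 / real k) + real k / (real k + 1) * (q a b / 2)"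
  proof -
    define u where "u = sqrt (1 + 1 / real k)"
    have u: "u > 0" "u\<^sup>2 = 1 + 1 / real k" using k by (auto simp: u_def add_pos_pos)
    define w where "w = real k / (real k + 1)"
    have w: "1 / u\<^sup>2 = w" unfolding u(2) w_def using k by (simp add: field_simps)
    \<comment> \<open>With \<open>u^2 = 1 + 1 / k\<close>, the reciprocal \<open>1 / u^2\<close> is
      the weight \<open>k / (k + 1)\<close> of the cost.\<close>
    have "0 \<le> (\<sigma> * u - sqrt (q a b) / u)\<^sup>2" by simp
    also have "\<dots> = \<sigma>\<^sup>2 * u\<^sup>2 + q a b * (1 / u\<^sup>2) - 2 * (\<sigma> * sqrt (q a b))"
      using u(1) q_nonneg[of a b] by (simp add: power2_diff power_mult_distrib power_divide)
    finally have "\<sigma> * sqrt (q a b) \<le> \<sigma>\<^sup>2 / 2 * u\<^sup>2 + w * (q a b / 2)"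
      unfolding w by (simp add: mult.commute[of w "q a b"])
    then show ?thesis unfolding u(2) w_def .
  qed
  finally have "e * h a - e * h b \<le> \<sigma>\<^sup>2 / 2 * (1 + 1 / real k) + real k / (real k + 1) * (q a b / 2)" .
  then have "exp (e * h a + real k * (- e * h b / real k))
      \<le> exp (\<sigma>\<^sup>2 / 2 * (1 + 1 / real k) + real k / (real k + 1) * (q a b / 2))"
    using k by simp
  then show "ennreal (exp (e * h a)) * ennreal (exp (- e * h b / real k)) ^ k
      \<le> ennreal (exp (\<sigma>\<^sup>2 / 2 * (1 + 1 / real k) + real k / (real k + 1) * (q a b / 2)))"
    by (simp only: exp_add exp_of_nat_mult ennreal_power ennreal_mult[symmetric] exp_ge_zero
          zero_le_power ennreal_leI)
qed auto

text \<open>For \<open>k = 1\<close>, \<open>pl_exp\<close> bounds the product of the integrals of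
  \<open>exp h\<close> and \<open>exp (- h)\<close>. Neither factor is zero, so both are
  finite.\<close>

lemma integrable_exp_lipschitz:
  assumes e: "e = 1 \<or> e = -1"
  shows "integrable \<mu> (\<lambda>a. exp (e * h a))"
proof -
  have "(\<integral>\<^sup>+a. ennreal (exp (- e * h a)) \<partial>\<mu>) \<noteq> 0"
  proof
    assume "(\<integral>\<^sup>+a. ennreal (exp (- e * h a)) \<partial>\<mu>) = 0"
    then have "AE a in \<mu>. ennreal (exp (- e * h a)) = 0"
      by (subst (asm) nn_integral_0_iff_AE) auto
    then have "AE a in \<mu>. False" by eventually_elim (simp add: not_le)
    then show False using not_empty AE_False by simp
  qed
  moreover have "(\<integral>\<^sup>+a. ennreal (exp (e * h a)) \<partial>\<mu>) * (\<integral>\<^sup>+a. ennreal (exp (- e * h a)) \<partial>\<mu>) < \<top>"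
    using pl_exp[of 1 e] e by (simp add: le_less_trans)
  ultimately have "(\<integral>\<^sup>+a. ennreal (exp (e * h a)) \<partial>\<mu>) < \<top>"
    by (auto simp: less_top[symmetric] ennreal_top_mult)
  then show ?thesis by (simp add: integrable_iff_bounded)
qed

text \<open>Domination by \<open>exp h + exp (- h)\<close>; Jensen's inequality in
  \<open>mgf_lipschitz\<close> relies on this integrability.\<close>

lemma integrable_lipschitz: "integrable \<mu> h"
proof (rule Bochner_Integration.integrable_bound)
  show "integrable \<mu> (\<lambda>a. exp (1 * h a) + exp (- 1 * h a))"
    by (intro Bochner_Integration.integrable_add integrable_exp_lipschitz) auto
  have "\<bar>y\<bar> \<le> exp y + exp (- y)" for y :: real
  proof -
    have "\<bar>y\<bar> \<le> exp \<bar>y\<bar>" using exp_ge_add_one_self[of "\<bar>y\<bar>"] by linarith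
    also have "\<dots> \<le> exp y + exp (- y)" by (cases "y \<ge> 0") auto
    finally show ?thesis .
  qed
  then show "AE a in \<mu>. norm (h a) \<le> norm (exp (1 * h a) + exp (- 1 * h a))"
    by (auto intro!: AE_I2 simp: abs_of_pos add_pos_pos)
qed simp

theorem mgf_lipschitz:
  "(\<integral>\<^sup>+a. ennreal (exp (h a)) \<partial>\<mu>) \<le> ennreal (exp (expectation h + \<sigma>\<^sup>2 / 2))"
proof -
  have bound: "(\<integral>\<^sup>+a. ennreal (exp (h a)) \<partial>\<mu>)
      \<le> ennreal (exp (expectation h + \<sigma>\<^sup>2 / 2 * (1 + 1 / real k)))" if k: "k \<ge> 1" for k
  proof -
    define I where "I = (\<integral>\<^sup>+a. ennreal (exp (h a)) \<partial>\<mu>)"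
    \<comment> \<open>Jensen's inequality for \<open>- h / k\<close>; the \<open>k\<close>-th power
      of the left side is \<open>exp (- expectation h)\<close> for every \<open>k\<close>.\<close>
    have "ennreal (exp (expectation (\<lambda>a. - h a / real k)))
        \<le> (\<integral>\<^sup>+a. ennreal (exp (- h a / real k)) \<partial>\<mu>)"
      using integrable_lipschitz by (intro exp_integral_le_nn_integral_exp) simp
    then have "ennreal (exp (expectation (\<lambda>a. - h a / real k))) ^ k
        \<le> (\<integral>\<^sup>+a. ennreal (exp (- h a / real k)) \<partial>\<mu>) ^ k"
      by (rule power_mono) simp
    moreover have "ennreal (exp (expectation (\<lambda>a. - h a / real k))) ^ k = ennreal (exp (- expectation h))"
      using k by (simp add: ennreal_power exp_of_nat_mult[symmetric])
    ultimately have "I * ennreal (exp (- expectation h))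
        \<le> I * (\<integral>\<^sup>+a. ennreal (exp (- h a / real k)) \<partial>\<mu>) ^ k"
      by (intro mult_left_mono) auto
    also have "\<dots> \<le> ennreal (exp (\<sigma>\<^sup>2 / 2 * (1 + 1 / real k)))"
      using pl_exp[OF k, of 1] by (simp add: I_def)
    finally have "I * ennreal (exp (- expectation h)) * ennreal (exp (expectation h))
       \<le> ennreal (exp (\<sigma>\<^sup>2 / 2 * (1 + 1 / real k))) * ennreal (exp (expectation h))"
      by (rule mult_right_mono) simp
    then show ?thesis
      by (simp add: I_def mult.assoc ennreal_mult_exp_cancel[of "- expectation h", simplified]
          ennreal_mult[symmetric] exp_add[symmetric] add.commute)
  qed
  have "(\<lambda>k. ennreal (exp (expectation h + \<sigma>\<^sup>2 / 2 * (1 + 1 / real k))))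
     \<longlonglongrightarrow> ennreal (exp (expectation h + \<sigma>\<^sup>2 / 2 * (1 + 0)))"
    by (intro tendsto_intros lim_1_over_n)
  moreover have "\<forall>\<^sub>F k in sequentially. (\<integral>\<^sup>+a. ennreal (exp (h a)) \<partial>\<mu>)
      \<le> ennreal (exp (expectation h + \<sigma>\<^sup>2 / 2 * (1 + 1 / real k)))"
    using bound by (rule eventually_sequentiallyI)
  ultimately have "(\<integral>\<^sup>+a. ennreal (exp (h a)) \<partial>\<mu>)
      \<le> ennreal (exp (expectation h + \<sigma>\<^sup>2 / 2 * (1 + 0)))"
    by (rule tendsto_lowerbound) simp
  then show ?thesis by simp
qed

end

end

text \<open>Chernoff's bound for \<open>l * h\<close>, which has Lipschitz constant
  \<open>l * \<sigma>\<close>. Any positive \<open>V\<close> with \<open>\<sigma>^2 \<le> V\<close>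
  serves as variance proxy.\<close>

lemma (in gaussian_pl) concentration_lipschitz:
  assumes h[measurable]: "h \<in> borel_measurable \<mu>"
    and lip: "\<And>a b. a \<in> space \<mu> \<Longrightarrow> b \<in> space \<mu> \<Longrightarrow> \<bar>h a - h b\<bar> \<le> \<sigma> * sqrt (q a b)"
    and V: "\<sigma>\<^sup>2 \<le> V" "V > 0" and r: "r > 0"
  shows "prob {a \<in> space \<mu>. h a \<ge> expectation h + r} \<le> exp (- r\<^sup>2 / (2 * V))"
proof -
  \<comment> \<open>The minimiser of \<open>l^2 * V / 2 - l * r\<close>.\<close>
  define l where "l = r / V"
  have l: "l > 0" using V r by (simp add: l_def)
  have "\<bar>l * h a - l * h b\<bar> \<le> (l * \<sigma>) * sqrt (q a b)"
    if "a \<in> space \<mu>" "b \<in> space \<mu>" for a b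
  proof -
    have "\<bar>l * h a - l * h b\<bar> = l * \<bar>h a - h b\<bar>"
      using l by (simp add: abs_mult right_diff_distrib[symmetric])
    then show ?thesis using lip[OF that] l by (simp add: mult.assoc)
  qed
  then have mgf: "(\<integral>\<^sup>+a. ennreal (exp (l * h a)) \<partial>\<mu>)
      \<le> ennreal (exp (expectation (\<lambda>a. l * h a) + (l * \<sigma>)\<^sup>2 / 2))"
    by (intro mgf_lipschitz) auto
  have "emeasure \<mu> {a \<in> space \<mu>. h a \<ge> expectation h + r}
     \<le> ennreal (exp (- l * (expectation h + r))) * (\<integral>\<^sup>+a. ennreal (exp (l * h a)) * indicator (space \<mu>) a \<partial>\<mu>)"
    using l by (intro Chernoff_ineq_nn_integral_ge) auto
  also have "(\<integral>\<^sup>+a. ennreal (exp (l * h a)) * indicator (space \<mu>) a \<partial>\<mu>) = (\<integral>\<^sup>+a. ennreal (exp (l * h a)) \<partial>\<mu>)"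
    by (intro nn_integral_cong) simp
  also have "ennreal (exp (- l * (expectation h + r))) * \<dots>
     \<le> ennreal (exp (- l * (expectation h + r))) * ennreal (exp (expectation (\<lambda>a. l * h a) + (l * \<sigma>)\<^sup>2 / 2))"
    by (intro mult_left_mono mgf) simp
  also have "\<dots> = ennreal (exp (l\<^sup>2 * \<sigma>\<^sup>2 / 2 - l * r))"
    by (simp add: ennreal_mult[symmetric] exp_add[symmetric] power_mult_distrib algebra_simps)
  also have "\<dots> \<le> ennreal (exp (- r\<^sup>2 / (2 * V)))"
  proof -
    have "l\<^sup>2 * \<sigma>\<^sup>2 / 2 - l * r \<le> l\<^sup>2 * V / 2 - l * r"
      using V by (intro diff_right_mono divide_right_mono mult_left_mono) auto
    also have "\<dots> = - r\<^sup>2 / (2 * V)"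
      using V by (simp add: l_def field_simps power2_eq_square)
    finally show ?thesis by (intro ennreal_leI) simp
  qed
  finally show ?thesis by (simp add: emeasure_eq_measure)
qed

subsection \<open>Contraction of the gradient step\<close>

text \<open>Along the segment from \<open>y\<close> to \<open>z\<close>, \<open>\<psi>\<close> is
  \<open>U\<close> minus the quadratic bound, up to a constant; its derivative is at most 0 by
  Cauchy-Schwarz and the Lipschitz gradient.\<close>

lemma descent_lemma:
  fixes U :: "'a::real_inner \<Rightarrow> real"
  assumes grad: "\<And>y. GDERIV U y :> gradU y"
    and lip: "\<And>y z. norm (gradU y - gradU z) \<le> L * norm (y - z)"
  shows "U z \<le> U y + gradU y \<bullet> (z - y) + L / 2 * (norm (z - y))\<^sup>2"
proof -
  define w where "w = z - y"
  define \<psi> where "\<psi> t = U (y + t *\<^sub>R w) - t * (gradU y \<bullet> w) - L / 2 * t\<^sup>2 * (norm w)\<^sup>2" for t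
  have deriv: "(\<psi> has_real_derivative (gradU (y + t *\<^sub>R w) \<bullet> w - gradU y \<bullet> w - L * t * (norm w)\<^sup>2)) (at t)" for t
  proof -
    have "(U has_derivative (\<lambda>h. h \<bullet> gradU (y + t *\<^sub>R w))) (at (y + t *\<^sub>R w))"
      using grad by (simp add: gderiv_def)
    moreover have "((\<lambda>t. y + t *\<^sub>R w) has_derivative (\<lambda>s. s *\<^sub>R w)) (at t)"
      by (auto intro!: derivative_eq_intros)
    ultimately have "((\<lambda>t. U (y + t *\<^sub>R w)) has_derivative (\<lambda>s. (s *\<^sub>R w) \<bullet> gradU (y + t *\<^sub>R w))) (at t)"
      by (rule has_derivative_compose[rotated])
    then have "((\<lambda>t. U (y + t *\<^sub>R w)) has_real_derivative (gradU (y + t *\<^sub>R w) \<bullet> w)) (at t)"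
      by (simp add: has_field_derivative_def inner_commute mult_commute_abs)
    then show ?thesis unfolding \<psi>_def by (auto intro!: derivative_eq_intros)
  qed
  have "\<psi> 1 \<le> \<psi> 0"
  proof (rule DERIV_nonpos_imp_nonincreasing[where f = \<psi>])
    fix t :: real assume t: "0 \<le> t" "t \<le> 1"
    have "gradU (y + t *\<^sub>R w) \<bullet> w - gradU y \<bullet> w = (gradU (y + t *\<^sub>R w) - gradU y) \<bullet> w"
      by (simp add: inner_diff_left)
    also have "\<dots> \<le> norm (gradU (y + t *\<^sub>R w) - gradU y) * norm w" by (rule norm_cauchy_schwarz)
    also have "\<dots> \<le> (L * norm (t *\<^sub>R w)) * norm w"
      using lip[of "y + t *\<^sub>R w" y] by (intro mult_right_mono) auto
    also have "\<dots> = L * t * (norm w)\<^sup>2" using t by (simp add: power2_eq_square)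
    finally show "\<exists>d. (\<psi> has_real_derivative d) (at t) \<and> d \<le> 0" using deriv[of t] by auto
  qed simp
  then show ?thesis by (simp add: \<psi>_def w_def)
qed

locale smooth_strongly_convex =
  fixes U :: "'a::euclidean_space \<Rightarrow> real" and gradU :: "'a \<Rightarrow> 'a" and L m :: real
  assumes grad: "\<And>y. GDERIV U y :> gradU y"
    and m_pos: "m > 0"
    and grad_lip: "\<And>y z. norm (gradU y - gradU z) \<le> L * norm (y - z)"
    and strong_convex:
      "\<And>y z. U z \<ge> U y + gradU y \<bullet> (z - y) + (m / 2) * (norm (y - z))\<^sup>2"
begin

text \<open>Add the strong convexity inequalities from \<open>x\<close> to \<open>y\<close> and from
  \<open>y\<close> to \<open>x\<close>; the values of \<open>U\<close> cancel.\<close>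

lemma grad_strongly_monotone: "m * (norm (x - y))\<^sup>2 \<le> (gradU x - gradU y) \<bullet> (x - y)"
proof -
  have "gradU y \<bullet> (x - y) + gradU x \<bullet> (y - x) + m * (norm (x - y))\<^sup>2 \<le> 0"
    using strong_convex[of y x] strong_convex[of x y]
    by (simp add: norm_minus_commute field_simps)
  then show ?thesis by (simp add: inner_diff_left inner_diff_right)
qed

text \<open>Strong monotonicity bounds the change of the gradient from below, the Lipschitz
  condition from above; a unit vector compares the two constants.\<close>

lemma m_le_L: "m \<le> L"
proof -
  obtain b :: 'a where b: "b \<in> Basis" using SOME_Basis by blast
  have "m * (norm (b - 0))\<^sup>2 \<le> norm (gradU b - gradU 0) * norm (b - 0)"
    using grad_strongly_monotone[of b 0] norm_cauchy_schwarz order_trans by blast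
  also have "\<dots> \<le> (L * norm (b - 0)) * norm (b - 0)"
    by (intro mult_right_mono grad_lip) auto
  finally show ?thesis using b by simp
qed

lemma L_pos: "L > 0" using m_le_L m_pos by simp

text \<open>This is cocoercivity, with constant \<open>1 / (L - m)\<close>, of the gradient of the
  convex function obtained from \<open>U\<close> by subtracting \<open>m / 2\<close> times the
  squared norm. The case \<open>m = L\<close> excludes that division and follows from strong
  monotonicity and the Lipschitz condition.\<close>

lemma grad_cocoercive:
  defines "p x y \<equiv> gradU x - gradU y"
  shows "m * L * (norm (x - y))\<^sup>2 + (norm (p x y))\<^sup>2 \<le> (m + L) * (p x y \<bullet> (x - y))"
proof (cases "m = L")
  case True
  have "(norm (p x y))\<^sup>2 \<le> (L * norm (x - y))\<^sup>2"
    unfolding p_def by (intro power_mono grad_lip) simp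
  then have "m * L * (norm (x - y))\<^sup>2 + (norm (p x y))\<^sup>2 \<le> 2 * m * (m * (norm (x - y))\<^sup>2)"
    using True by (simp add: power_mult_distrib power2_eq_square mult_ac)
  also have "\<dots> \<le> 2 * m * (p x y \<bullet> (x - y))"
    unfolding p_def using m_pos by (intro mult_left_mono grad_strongly_monotone) auto
  finally show ?thesis using True by simp
next
  case False
  then have mL: "L - m > 0" using m_le_L by simp
  have dbl: "a / c = 2 * (a / (2 * c))" for a c :: real by simp
  text \<open>Compare the quadratic lower bound at \<open>y\<close> with the quadratic upper bound at \<open>x\<close> in the
    point where their difference is largest.\<close>
  have half: "gradU y \<bullet> (x - y) + m / 2 * (norm (x - y))\<^sup>2
       + (norm (m *\<^sub>R (x - y) - p x y))\<^sup>2 / (2 * (L - m)) \<le> U x - U y" for x y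
  proof -
    define v where "v = m *\<^sub>R (x - y) - p x y"
    define u where "u = (1 / (L - m)) *\<^sub>R v"
    have "U y + gradU y \<bullet> (x + u - y) + m / 2 * (norm (y - (x + u)))\<^sup>2
       \<le> U x + gradU x \<bullet> (x + u - x) + L / 2 * (norm (x + u - x))\<^sup>2"
      using strong_convex[where y = y and z = "x + u"] descent_lemma[OF grad grad_lip, where y = x and z = "x + u"]
      by linarith
    moreover have "(norm (y - (x + u)))\<^sup>2 = (norm (x - y))\<^sup>2 + 2 * (u \<bullet> (x - y)) + (norm u)\<^sup>2"
      unfolding power2_norm_eq_inner by (simp add: inner_simps inner_commute)
    ultimately have "U y + gradU y \<bullet> (x + u - y)
         + m / 2 * ((norm (x - y))\<^sup>2 + 2 * (u \<bullet> (x - y)) + (norm u)\<^sup>2)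
       \<le> U x + gradU x \<bullet> (x + u - x) + L / 2 * (norm (x + u - x))\<^sup>2"
      by (simp only:)
    then have *: "gradU y \<bullet> (x - y) + m / 2 * (norm (x - y))\<^sup>2 + u \<bullet> v - (L - m) / 2 * (norm u)\<^sup>2
       \<le> U x - U y"
      by (simp add: v_def p_def inner_simps inner_commute field_simps)
    define W where "W = (norm v)\<^sup>2 / (2 * (L - m))"
    have "u \<bullet> v = (norm v)\<^sup>2 / (L - m)"
      by (simp add: u_def power2_norm_eq_inner)
    also have "\<dots> = 2 * W" unfolding W_def by (rule dbl)
    finally have "u \<bullet> v = 2 * W" .
    moreover have "(L - m) / 2 * (norm u)\<^sup>2 = W"
      using mL by (simp add: u_def W_def power_mult_distrib power_divide power2_eq_square)
    ultimately have "gradU y \<bullet> (x - y) + m / 2 * (norm (x - y))\<^sup>2 + 2 * W - W \<le> U x - U y"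
      using * by (simp only:)
    then show ?thesis unfolding W_def[symmetric] v_def[symmetric] by linarith
  qed
  define N where "N = (norm (m *\<^sub>R (x - y) - p x y))\<^sup>2"
  have sym: "norm (m *\<^sub>R (y - x) - p y x) = norm (m *\<^sub>R (x - y) - p x y)"
    by (subst norm_minus_cancel[symmetric]) (simp add: p_def algebra_simps)
  \<comment> \<open>Adding \<open>half\<close> for both orders of the two points cancels the values
    of \<open>U\<close>.\<close>
  have "gradU y \<bullet> (x - y) + gradU x \<bullet> (y - x) + m * (norm (x - y))\<^sup>2
       + 2 * (N / (2 * (L - m))) \<le> 0"
    using half[of y x] half[of x y] unfolding sym N_def[symmetric]
    by (simp add: norm_minus_commute)
  then have "gradU y \<bullet> (x - y) + gradU x \<bullet> (y - x) + m * (norm (x - y))\<^sup>2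
       + N / (L - m) \<le> 0"
    by (simp only: dbl[of N "L - m", symmetric])
  then have "m * (norm (x - y))\<^sup>2 + N / (L - m) \<le> p x y \<bullet> (x - y)"
    by (simp add: p_def inner_diff_left inner_diff_right)
  then have "(L - m) * (m * (norm (x - y))\<^sup>2 + N / (L - m)) \<le> (L - m) * (p x y \<bullet> (x - y))"
    using mL by (intro mult_left_mono) auto
  then have "(L - m) * m * (norm (x - y))\<^sup>2 + N \<le> (L - m) * (p x y \<bullet> (x - y))"
    using mL by (simp add: distrib_left)
  moreover have "N = m\<^sup>2 * (norm (x - y))\<^sup>2 - 2 * m * (p x y \<bullet> (x - y)) + (norm (p x y))\<^sup>2"
    unfolding N_def power2_norm_eq_inner
    by (simp add: inner_simps inner_commute power2_eq_square algebra_simps)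
  ultimately show ?thesis by (simp add: algebra_simps power2_eq_square)
qed

lemma kappa_pos: "kappa m L > 0"
  unfolding kappa_def using m_pos L_pos by (auto intro!: divide_pos_pos mult_pos_pos add_pos_pos)

text \<open>Amounts to \<open>4 * m * L \<le> (m + L)^2\<close>; it keeps the radicand of the
  contraction factor non-negative.\<close>

lemma kappa_step_le_1:
  assumes "0 < g" "g \<le> 2 / (m + L)"
  shows "kappa m L * g \<le> 1"
proof -
  have "kappa m L * g \<le> kappa m L * (2 / (m + L))"
    using assms kappa_pos by (intro mult_left_mono) auto
  also have "\<dots> \<le> 1"
  proof -
    have "0 \<le> (m - L)\<^sup>2" by simp
    then have "4 * (m * L) \<le> (m + L) * (m + L)" by (simp add: power2_eq_square algebra_simps)
    then show ?thesis using m_pos L_pos by (simp add: kappa_def)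
  qed
  finally show ?thesis .
qed

text \<open>In the expanded square, \<open>grad_cocoercive\<close> turns the cross term into a
  multiple of \<open>(norm (x - y))^2\<close>, which produces the factor, and a multiple of
  \<open>(norm p)^2\<close>, which absorbs the term quadratic in \<open>g\<close> because
  \<open>g \<le> 2 / (m + L)\<close>.\<close>

lemma gradient_step_contraction:
  assumes g: "0 < g" "g \<le> 2 / (m + L)"
  shows "norm ((x - g *\<^sub>R gradU x) - (y - g *\<^sub>R gradU y)) \<le> sqrt (1 - kappa m L * g) * norm (x - y)"
proof -
  define p where "p = gradU x - gradU y"
  have mL: "m + L > 0" using m_pos L_pos by simp
  have half: "2 * a / b / 2 = a / b" for a b :: real by simp
  have "kappa m L / 2 = m * L / (m + L)"
    unfolding kappa_def using half[of "m * L" "m + L"] by (simp only: mult.assoc)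
  then have "kappa m L / 2 * (norm (x - y))\<^sup>2 + (norm p)\<^sup>2 / (m + L)
      = (m * L * (norm (x - y))\<^sup>2 + (norm p)\<^sup>2) / (m + L)"
    by (simp only: add_divide_distrib times_divide_eq_left)
  also have "\<dots> \<le> p \<bullet> (x - y)"
    using grad_cocoercive[of x y] mL by (simp add: p_def divide_le_eq mult.commute)
  finally have coc: "kappa m L / 2 * (norm (x - y))\<^sup>2 + (norm p)\<^sup>2 / (m + L) \<le> p \<bullet> (x - y)" .
  have "(norm ((x - g *\<^sub>R gradU x) - (y - g *\<^sub>R gradU y)))\<^sup>2 = (norm ((x - y) - g *\<^sub>R p))\<^sup>2"
    by (simp add: p_def algebra_simps)
  also have "\<dots> = (norm (x - y))\<^sup>2 - 2 * g * (p \<bullet> (x - y)) + g * (g * (norm p)\<^sup>2)"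
    unfolding power2_norm_eq_inner by (simp add: inner_simps inner_commute algebra_simps)
  also have "\<dots> \<le> (norm (x - y))\<^sup>2
      - 2 * g * (kappa m L / 2 * (norm (x - y))\<^sup>2 + (norm p)\<^sup>2 / (m + L)) + g * (2 / (m + L) * (norm p)\<^sup>2)"
    using coc g by (intro add_mono diff_left_mono mult_left_mono mult_right_mono) auto
  also have "\<dots> = (1 - kappa m L * g) * (norm (x - y))\<^sup>2"
    by (simp add: algebra_simps)
  also have "\<dots> = (sqrt (1 - kappa m L * g) * norm (x - y))\<^sup>2"
    using kappa_step_le_1[OF g] by (simp add: power_mult_distrib)
  finally show ?thesis
    by (rule power2_le_imp_le) (use kappa_step_le_1[OF g] in simp)
qed

end

subsection \<open>Sensitivity to the noise\<close>

text \<open>The cross term is split by AM-GM, using that \<open>p\<close> is at most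
  \<open>sqrt (a * P)\<close>. In the inductions below, \<open>P\<close> collects the past squared
  noise differences and \<open>d\<close> is the new difference, so one noise term is added at a
  time.\<close>

lemma cauchy_schwarz_step:
  fixes p P a b d :: real
  assumes "p\<^sup>2 \<le> a * P" "a \<ge> 0" "P \<ge> 0" "b \<ge> 0" "d \<ge> 0" "p \<ge> 0"
  shows "(p + sqrt b * d)\<^sup>2 \<le> (a + b) * (P + d\<^sup>2)"
proof -
  have "p * sqrt b * d = sqrt (p\<^sup>2 * b * d\<^sup>2)"
    using assms by (simp add: real_sqrt_mult)
  also have "\<dots> \<le> sqrt ((b * P) * (a * d\<^sup>2))"
  proof (rule real_sqrt_le_mono)
    have "p\<^sup>2 * (b * d\<^sup>2) \<le> a * P * (b * d\<^sup>2)" using assms by (intro mult_right_mono) auto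
    then show "p\<^sup>2 * b * d\<^sup>2 \<le> (b * P) * (a * d\<^sup>2)" by (simp add: mult_ac)
  qed
  also have "\<dots> \<le> (b * P + a * d\<^sup>2) / 2"
    using assms by (intro arith_geo_mean_sqrt) auto
  finally have "2 * (p * sqrt b * d) \<le> b * P + a * d\<^sup>2" by simp
  moreover have "(p + sqrt b * d)\<^sup>2 = p\<^sup>2 + 2 * (p * sqrt b * d) + b * d\<^sup>2"
    using assms by (simp add: power2_sum power_mult_distrib)
  ultimately show ?thesis using assms(1) by (simp add: algebra_simps)
qed

text \<open>\<open>\<delta> k\<close> is the distance at time \<open>k\<close> between two chains
  with the same starting point and different noise, and \<open>\<Delta> k\<close> the distance
  between their \<open>k\<close>-th noise vectors.\<close>

locale perturbed_contraction =
  fixes \<gamma> \<delta> \<Delta> :: "nat \<Rightarrow> real" and \<kappa> :: real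
  assumes kappa: "\<kappa> > 0"
    and gamma_pos: "\<And>k. k \<ge> 1 \<Longrightarrow> \<gamma> k > 0"
    and gamma_le: "\<And>k. k \<ge> 1 \<Longrightarrow> \<kappa> * \<gamma> k \<le> 1"
    and nonneg: "\<And>k. \<delta> k \<ge> 0" "\<And>k. \<Delta> k \<ge> 0"
    and init: "\<delta> 0 = 0"
    and step: "\<And>k. \<delta> (Suc k) \<le> sqrt (1 - \<kappa> * \<gamma> (Suc k)) * \<delta> k + sqrt (2 * \<gamma> (Suc k)) * \<Delta> (Suc k)"
begin

text \<open>The constant \<open>2 / \<kappa>\<close> is the fixed point of
  \<open>c \<mapsto> (1 - \<kappa> * g) * c + 2 * g\<close> for every step size \<open>g\<close>, so
  \<open>cauchy_schwarz_step\<close> reproduces it.\<close>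

lemma delta_bound: "(\<delta> j)\<^sup>2 \<le> 2 / \<kappa> * (\<Sum>k=1..j. (\<Delta> k)\<^sup>2)"
proof (induction j)
  case 0
  then show ?case using init by simp
next
  case (Suc j)
  let ?g = "\<gamma> (Suc j)" and ?P = "\<Sum>k=1..j. (\<Delta> k)\<^sup>2"
  have g: "?g > 0" "\<kappa> * ?g \<le> 1" using gamma_pos gamma_le by auto
  have "(\<delta> (Suc j))\<^sup>2 \<le> (sqrt (1 - \<kappa> * ?g) * \<delta> j + sqrt (2 * ?g) * \<Delta> (Suc j))\<^sup>2"
    using step nonneg by (intro power_mono) auto
  also have "\<dots> \<le> ((1 - \<kappa> * ?g) * (2 / \<kappa>) + 2 * ?g) * (?P + (\<Delta> (Suc j))\<^sup>2)"
  proof (rule cauchy_schwarz_step)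
    have "(1 - \<kappa> * ?g) * (\<delta> j)\<^sup>2 \<le> (1 - \<kappa> * ?g) * (2 / \<kappa> * ?P)"
      using g Suc by (intro mult_left_mono) auto
    moreover have "(sqrt (1 - \<kappa> * ?g) * \<delta> j)\<^sup>2 = (1 - \<kappa> * ?g) * (\<delta> j)\<^sup>2"
      using g by (simp add: power_mult_distrib)
    ultimately show "(sqrt (1 - \<kappa> * ?g) * \<delta> j)\<^sup>2 \<le> (1 - \<kappa> * ?g) * (2 / \<kappa>) * ?P"
      by (simp only: mult.assoc)
  qed (use g nonneg kappa in \<open>auto intro!: sum_nonneg\<close>)
  also have "(1 - \<kappa> * ?g) * (2 / \<kappa>) + 2 * ?g = 2 / \<kappa>"
    using kappa by (simp add: field_simps)
  finally show ?case by simp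
qed

text \<open>Since \<open>sqrt (1 - \<kappa> * \<gamma>) \<le> 1 - \<kappa> * \<gamma> / 2\<close>, the term \<open>\<gamma> (i + 1) * \<delta> i\<close> is absorbed by
  the decrease of \<open>2 / \<kappa> * \<delta>\<close> in the next step.\<close>

lemma weighted_delta_bound_aux:
  "(2 / \<kappa> * \<delta> (N + 1 + j) + (\<Sum>i=N+1..N+j. \<gamma> (i + 1) * \<delta> i))\<^sup>2
   \<le> (8 / \<kappa>\<^sup>2 * (1 / \<kappa> + (\<Sum>k=N+2..N+1+j. \<gamma> k))) * (\<Sum>k=1..N+1+j. (\<Delta> k)\<^sup>2)"
proof (induction j)
  case 0
  \<comment> \<open>\<open>(2 / \<kappa>)^2 * (2 / \<kappa>)\<close> equals
    \<open>8 / \<kappa>^2 * (1 / \<kappa>)\<close>, the source of the summand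
    \<open>1 / \<kappa>\<close>.\<close>
  have "(2 / \<kappa>)\<^sup>2 * (\<delta> (N + 1))\<^sup>2 \<le> (2 / \<kappa>)\<^sup>2 * (2 / \<kappa> * (\<Sum>k=1..N+1. (\<Delta> k)\<^sup>2))"
    by (intro mult_left_mono delta_bound) auto
  then show ?case by (simp add: power_mult_distrib power_divide)
next
  case (Suc j)
  let ?k = "Suc (N + 1 + j)"
  let ?g = "\<gamma> ?k" and ?A = "2 / \<kappa> * \<delta> (N + 1 + j) + (\<Sum>i=N+1..N+j. \<gamma> (i + 1) * \<delta> i)"
  let ?S = "\<Sum>k=N+2..N+1+j. \<gamma> k" and ?D = "\<Sum>k=1..N+1+j. (\<Delta> k)\<^sup>2"
  have g: "?g > 0" "\<kappa> * ?g \<le> 1" using gamma_pos gamma_le by auto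
  have nnS: "(\<Sum>i=N+1..N+l. \<gamma> (i + 1) * \<delta> i) \<ge> 0" for l
    using gamma_pos nonneg by (intro sum_nonneg mult_nonneg_nonneg) (auto intro: less_imp_le)
  have "sqrt (1 - \<kappa> * ?g) \<le> 1 - \<kappa> * ?g / 2"
    using g kappa by (intro real_le_lsqrt) (auto simp: power2_eq_square field_simps)
  then have "\<delta> ?k \<le> (1 - \<kappa> * ?g / 2) * \<delta> (N + 1 + j) + sqrt (2 * ?g) * \<Delta> ?k"
    using step[of "N + 1 + j"] nonneg by (meson add_right_mono mult_right_mono order_trans)
  then have "2 / \<kappa> * \<delta> ?k
      \<le> 2 / \<kappa> * ((1 - \<kappa> * ?g / 2) * \<delta> (N + 1 + j) + sqrt (2 * ?g) * \<Delta> ?k)"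
    using kappa by (intro mult_left_mono) auto
  also have "\<dots> = 2 / \<kappa> * \<delta> (N + 1 + j) - ?g * \<delta> (N + 1 + j) + 2 / \<kappa> * sqrt (2 * ?g) * \<Delta> ?k"
    using kappa by (simp add: field_simps)
  \<comment> \<open>As a square root, the noise coefficient shows what
    \<open>cauchy_schwarz_step\<close> adds to the constant: \<open>8 / \<kappa>^2 * ?g\<close>, one
    more step size in the sum.\<close>
  also have "2 / \<kappa> * sqrt (2 * ?g) = sqrt (8 / \<kappa>\<^sup>2 * ?g)"
  proof -
    have "sqrt (8 / \<kappa>\<^sup>2 * ?g) = sqrt ((2 / \<kappa>)\<^sup>2 * (2 * ?g))" by (simp add: power_divide)
    also have "\<dots> = 2 / \<kappa> * sqrt (2 * ?g)" using kappa by (simp only: real_sqrt_mult) simp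
    finally show ?thesis by simp
  qed
  finally have "2 / \<kappa> * \<delta> (N + 1 + Suc j) + (\<Sum>i=N+1..N+Suc j. \<gamma> (i + 1) * \<delta> i)
     \<le> ?A + sqrt (8 / \<kappa>\<^sup>2 * ?g) * \<Delta> ?k"
    by simp
  then have "(2 / \<kappa> * \<delta> (N + 1 + Suc j) + (\<Sum>i=N+1..N+Suc j. \<gamma> (i + 1) * \<delta> i))\<^sup>2
     \<le> (?A + sqrt (8 / \<kappa>\<^sup>2 * ?g) * \<Delta> ?k)\<^sup>2"
    by (rule power_mono) (use nonneg kappa in \<open>intro add_nonneg_nonneg mult_nonneg_nonneg nnS; simp\<close>)
  also have "\<dots> \<le> (8 / \<kappa>\<^sup>2 * (1 / \<kappa> + ?S) + 8 / \<kappa>\<^sup>2 * ?g) * (?D + (\<Delta> ?k)\<^sup>2)"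
  proof (rule cauchy_schwarz_step[OF Suc])
    have "?S \<ge> 0" using gamma_pos by (intro sum_nonneg) (auto intro: less_imp_le)
    then show "0 \<le> 8 / \<kappa>\<^sup>2 * (1 / \<kappa> + ?S)" using kappa by simp
    show "0 \<le> ?D" by (intro sum_nonneg) simp
    show "0 \<le> ?A" using nonneg kappa nnS by (intro add_nonneg_nonneg mult_nonneg_nonneg) auto
  qed (use g nonneg in auto)
  also have "8 / \<kappa>\<^sup>2 * (1 / \<kappa> + ?S) + 8 / \<kappa>\<^sup>2 * ?g = 8 / \<kappa>\<^sup>2 * (1 / \<kappa> + (\<Sum>k=N+2..N+1+Suc j. \<gamma> k))"
    by (simp add: distrib_left add.assoc)
  finally show ?case by simp
qed

text \<open>No later step absorbs the last summand; \<open>\<kappa> * \<gamma> k \<le> 1\<close>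
  bounds it by \<open>2 / \<kappa> * \<delta> (N + n)\<close>, so only noise up to index
  \<open>N + n\<close> enters. The sum of step sizes is then enlarged by
  \<open>\<gamma> (N + n + 1)\<close> to match \<open>step_sum\<close>.\<close>

lemma weighted_delta_bound:
  assumes "n \<ge> 1"
  shows "(\<Sum>i=N+1..N+n. \<gamma> (i + 1) * \<delta> i)
     \<le> sqrt (8 / \<kappa>\<^sup>2 * (1 / \<kappa> + step_sum \<gamma> (N + 2) (N + n + 1))) * sqrt (\<Sum>k=1..N+n. (\<Delta> k)\<^sup>2)"
proof -
  obtain j where n: "n = Suc j" using assms by (cases n) auto
  let ?D = "\<Sum>k=1..N+n. (\<Delta> k)\<^sup>2"
  have "\<kappa> * \<gamma> (N + n + 1) \<le> 2" using gamma_le[of "N + n + 1"] by simp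
  then have "\<gamma> (N + n + 1) \<le> 2 / \<kappa>" using kappa by (simp add: field_simps)
  then have "\<gamma> (N + n + 1) * \<delta> (N + n) \<le> 2 / \<kappa> * \<delta> (N + n)"
    using nonneg by (intro mult_right_mono) auto
  then have "(\<Sum>i=N+1..N+n. \<gamma> (i + 1) * \<delta> i)
      \<le> 2 / \<kappa> * \<delta> (N + 1 + j) + (\<Sum>i=N+1..N+j. \<gamma> (i + 1) * \<delta> i)"
    by (simp add: n)
  also have "\<dots> \<le> sqrt ((8 / \<kappa>\<^sup>2 * (1 / \<kappa> + (\<Sum>k=N+2..N+1+j. \<gamma> k))) * ?D)"
    using weighted_delta_bound_aux[of N j] by (intro real_le_rsqrt) (simp add: n)
  also have "\<dots> \<le> sqrt ((8 / \<kappa>\<^sup>2 * (1 / \<kappa> + step_sum \<gamma> (N + 2) (N + n + 1))) * ?D)"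
  proof -
    have "(\<Sum>k=N+2..N+1+j. \<gamma> k) \<le> step_sum \<gamma> (N + 2) (N + n + 1)"
      unfolding step_sum_def n using gamma_pos by (intro sum_mono2) (auto intro: less_imp_le)
    then show ?thesis
      by (intro real_sqrt_le_mono mult_right_mono mult_left_mono) (auto intro!: sum_nonneg)
  qed
  finally show ?thesis by (simp only: real_sqrt_mult)
qed

end

subsection \<open>The unadjusted Langevin chain\<close>

text \<open>A Lipschitz function has bounded difference quotients, so the real supremum in
  \<open>lip_const\<close> is a genuine upper bound.\<close>

lemma lip_const_bound:
  fixes f :: "real ^ 'n \<Rightarrow> real"
  assumes "\<exists>C. C-lipschitz_on UNIV f"
  shows "lip_const f \<ge> 0" "\<bar>f y - f z\<bar> \<le> lip_const f * norm (y - z)"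
proof -
  let ?Q = "\<lambda>(x, y). \<bar>f x - f y\<bar> / norm (x - y)"
  obtain C where C: "C-lipschitz_on UNIV f" using assms by blast
  have "\<bar>f x - f y\<bar> \<le> C * norm (x - y)" for x y
    using lipschitz_onD[OF C, of x y] by (simp add: dist_norm)
  then have bdd: "bdd_above (?Q ` {(x, y). x \<noteq> y})"
    by (auto simp: bdd_above_def divide_le_eq intro!: exI[of _ C])
  have upper: "\<bar>f y - f z\<bar> / norm (y - z) \<le> lip_const f" if "y \<noteq> z" for y z
    unfolding lip_const_def using that cSUP_upper[OF _ bdd, of "(y, z)"] by simp
  show "\<bar>f y - f z\<bar> \<le> lip_const f * norm (y - z)"
    using upper[of y z] by (cases "y = z") (auto simp: divide_le_eq)
  have "0 \<le> \<bar>f 0 - f 1\<bar> / norm (0 - 1 :: real ^ 'n)" by simp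
  also have "\<dots> \<le> lip_const f" by (rule upper) (simp add: vec_eq_iff)
  finally show "lip_const f \<ge> 0" .
qed

text \<open>Using the coordinate maps as noise turns the chain into a function of the noise sequence
  itself; up to time \<open>K\<close> it reads only \<open>Z 1\<close> to
  \<open>Z K\<close>.\<close>

lemma ula_chain_restrict:
  "k \<le> K \<Longrightarrow> ula_chain gradU \<gamma> (\<lambda>i \<zeta>. \<zeta> i) x k (\<lambda>i\<in>{1..K}. Z i \<omega>) = ula_chain gradU \<gamma> Z x k \<omega>"
  by (induction k) auto

lemma ula_chain_measurable:
  assumes [measurable]: "gradU \<in> borel_measurable borel"
  shows "k \<le> K \<Longrightarrow> ula_chain gradU \<gamma> (\<lambda>i \<zeta>. \<zeta> i) x k \<in> borel_measurable (PiM {1..K} (\<lambda>_. borel))"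
proof (induction k)
  case 0
  have "ula_chain gradU \<gamma> (\<lambda>i \<zeta>. \<zeta> i) x 0 = (\<lambda>_. x)" by (simp add: fun_eq_iff)
  then show ?case by simp
next
  case (Suc k)
  then have [measurable]: "ula_chain gradU \<gamma> (\<lambda>i \<zeta>. \<zeta> i) x k \<in> borel_measurable (PiM {1..K} (\<lambda>_. borel))"
    by simp
  have [measurable]: "(\<lambda>\<zeta>. \<zeta> (Suc k)) \<in> measurable (PiM {1..K} (\<lambda>_. borel)) (borel :: (real ^ 'a) measure)"
    using Suc.prems by (intro measurable_component_singleton) auto
  have "ula_chain gradU \<gamma> (\<lambda>i \<zeta>. \<zeta> i) x (Suc k)
     = (\<lambda>\<zeta>. ula_chain gradU \<gamma> (\<lambda>i \<zeta>. \<zeta> i) x k \<zeta>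
         - \<gamma> (Suc k) *\<^sub>R gradU (ula_chain gradU \<gamma> (\<lambda>i \<zeta>. \<zeta> i) x k \<zeta>)
         + sqrt (2 * \<gamma> (Suc k)) *\<^sub>R \<zeta> (Suc k))"
    by (simp add: fun_eq_iff)
  also have "\<dots> \<in> borel_measurable (PiM {1..K} (\<lambda>_. borel))" by measurable
  finally show ?case .
qed

lemma prob_space_std_gaussian: "prob_space (std_gaussian :: (real ^ 'n) measure)"
  unfolding std_gaussian_eq_distr
  by (intro prob_space.prob_space_distr prob_space_PiM prob_space_std_normal) measurable

text \<open>A second tensorisation, now over the time index: the squared distances of the
  \<open>K\<close> noise vectors add up.\<close>

lemma gaussian_pl_PiM_std_gaussian:
  fixes K :: nat
  shows "gaussian_pl (PiM {1..K} (\<lambda>_. std_gaussian :: (real ^ 'n) measure))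
     (\<lambda>a b. \<Sum>i=1..K. (norm (a i - b i))\<^sup>2)"
proof -
  interpret G: prob_space "std_gaussian :: (real ^ 'n) measure" by (rule prob_space_std_gaussian)
  interpret prob_space "PiM {1..K} (\<lambda>_. std_gaussian :: (real ^ 'n) measure)"
    by (intro prob_space_PiM prob_space_std_gaussian)
  show ?thesis
  proof
    fix k :: nat assume k: "k \<ge> 1"
    have "pl_ineq k (PiM {1..K} (\<lambda>_. std_gaussian :: (real ^ 'n) measure))
       (\<lambda>a b. \<Sum>i=1..K. real k / (real k + 1) * ((norm (a i - b i))\<^sup>2 / 2))"
      by (intro pl_ineq_PiM pl_ineq_std_gaussian k)
         (simp_all add: product_sigma_finite_def G.sigma_finite_measure)
    then show "pl_ineq k (PiM {1..K} (\<lambda>_. std_gaussian :: (real ^ 'n) measure))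
       (\<lambda>a b. real k / (real k + 1) * ((\<Sum>i=1..K. (norm (a i - b i))\<^sup>2) / 2))"
      by (simp only: sum_distrib_left sum_divide_distrib)
  qed (simp add: sum_nonneg)
qed

theorem theorem17:
  fixes U :: "real ^ 'n \<Rightarrow> real" and gradU :: "real ^ 'n \<Rightarrow> real ^ 'n"
    and L m r :: real and \<gamma> :: "nat \<Rightarrow> real"
    and M :: "'w measure" and Z :: "nat \<Rightarrow> 'w \<Rightarrow> real ^ 'n"
    and N n :: nat and f :: "real ^ 'n \<Rightarrow> real" and x :: "real ^ 'n"
  assumes grad: "\<And>y. GDERIV U y :> gradU y"
    and grad_cont: "continuous_on UNIV gradU"
    and L: "L \<ge> 0" and m: "m > 0"
    and grad_lip: "\<And>y z. norm (gradU y - gradU z) \<le> L * norm (y - z)"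
    and strong_convex:
      "\<And>y z. U z \<ge> U y + gradU y \<bullet> (z - y) + (m / 2) * (norm (y - z))\<^sup>2"
    and steps_pos: "\<And>k. k \<ge> 1 \<Longrightarrow> \<gamma> k > 0"
    and steps_noninc: "\<And>j k. 1 \<le> j \<Longrightarrow> j \<le> k \<Longrightarrow> \<gamma> k \<le> \<gamma> j"
    and first_step: "\<gamma> 1 \<le> 2 / (m + L)"
    and prob: "prob_space M"
    and noise: "iid_std_gaussian M Z"
    and n: "n \<ge> 1" and r: "r > 0"
    and f_lip: "\<exists>C. C-lipschitz_on UNIV f"
  shows "measure M {\<omega> \<in> space M.
           weighted_avg \<gamma> (ula_chain gradU \<gamma> Z x) N n f \<omega>
             \<ge> integral\<^sup>L M (weighted_avg \<gamma> (ula_chain gradU \<gamma> Z x) N n f) + r}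
         \<le> concentration_bound m L \<gamma> N n f r"
proof -
  interpret smooth_strongly_convex U gradU L m
    by unfold_locales (use assms in auto)
  interpret M: prob_space M by (rule prob)
  define K where "K = N + n"
  define \<mu> where "\<mu> = PiM {1..K} (\<lambda>_. std_gaussian :: (real ^ 'n) measure)"
  define q where "q a b = (\<Sum>i=1..K. (norm (a i - b i))\<^sup>2)" for a b :: "nat \<Rightarrow> real ^ 'n"
  interpret gaussian_pl \<mu> q
    unfolding \<mu>_def q_def by (rule gaussian_pl_PiM_std_gaussian)
  define X where "X = ula_chain gradU \<gamma> (\<lambda>i \<zeta>. \<zeta> i) x"
  define S where "S = weighted_avg \<gamma> X N n f"
  define \<kappa> where "\<kappa> = kappa m L"
  define \<Gamma> where "\<Gamma> = step_sum \<gamma> (N + 2) (N + n + 1)"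
  define F where "F = lip_const f"
  have F: "F \<ge> 0" and f_le: "\<bar>f y - f z\<bar> \<le> F * norm (y - z)" for y z
    using lip_const_bound[OF f_lip] by (auto simp: F_def)
  have kappa: "\<kappa> > 0" unfolding \<kappa>_def by (rule kappa_pos)
  have \<Gamma>: "\<Gamma> > 0"
    unfolding \<Gamma>_def step_sum_def using n steps_pos by (intro sum_pos) auto
  have step_le: "\<gamma> k \<le> 2 / (m + L)" if "k \<ge> 1" for k
    using steps_noninc[of 1 k] that first_step by simp

  \<comment> \<open>The law of the noise and the transfer of the event\<close>
  define R where "R \<omega> = (\<lambda>i\<in>{1..K}. Z i \<omega>)" for \<omega>
  have K: "K \<ge> 1" using n by (simp add: K_def)
  have dist: "distributed M lborel (Z k) (\<lambda>z. ennreal (std_gaussian_density z))" if "k \<ge> 1" for k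
    using noise that by (auto simp: iid_std_gaussian_def)
  have Zmeas: "Z k \<in> borel_measurable M" if "k \<ge> 1" for k
    using distributed_measurable[OF dist[OF that]] by simp
  have R: "R \<in> measurable M (PiM {1..K} (\<lambda>_. borel))"
    unfolding R_def using Zmeas by (intro measurable_restrict) auto
  have distr_R: "distr M (PiM {1..K} (\<lambda>_. borel)) R = \<mu>"
  proof -
    \<comment> \<open>Independence identifies the joint law with the product of the marginals; the
      index set is non-empty because \<open>K \<ge> 1\<close>.\<close>
    have "M.indep_vars (\<lambda>_. borel) Z {1..K}"
      using noise by (auto simp: iid_std_gaussian_def intro: M.indep_vars_subset)
    then have "distr M (PiM {1..K} (\<lambda>_. borel)) R = PiM {1..K} (\<lambda>i. distr M borel (Z i))"
      unfolding R_def using K Zmeas by (subst (asm) M.indep_vars_iff_distr_eq_PiM') auto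
    also have "\<dots> = \<mu>"
      unfolding \<mu>_def
    proof (rule PiM_cong[OF refl])
      fix i assume "i \<in> {1..K}"
      then have "distr M lborel (Z i) = std_gaussian"
        using distributed_distr_eq_density[OF dist[of i]] by simp
      then show "distr M borel (Z i) = std_gaussian" by (simp cong: distr_cong)
    qed
    finally show ?thesis .
  qed
  have sets_\<mu>: "sets \<mu> = sets (PiM {1..K} (\<lambda>_. borel))"
    unfolding distr_R[symmetric] by simp
  have "gradU \<in> borel_measurable borel"
    using grad_cont by (rule borel_measurable_continuous_onI)
  then have Xmeas: "X k \<in> borel_measurable (PiM {1..K} (\<lambda>_. borel))" if "k \<le> K" for k
    unfolding X_def using that by (rule ula_chain_measurable)
  have fmeas: "f \<in> borel_measurable borel"
    using f_lip lipschitz_on_continuous_on by (blast intro: borel_measurable_continuous_onI)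
  have S_PiM: "S \<in> borel_measurable (PiM {1..K} (\<lambda>_. borel))"
    unfolding S_def weighted_avg_def[abs_def]
    by (intro borel_measurable_sum borel_measurable_times borel_measurable_const
          measurable_compose[OF Xmeas fmeas]) (auto simp: K_def)
  then have S_\<mu>: "S \<in> borel_measurable \<mu>"
    using measurable_cong_sets[OF sets_\<mu> refl] by blast
  have S_R: "weighted_avg \<gamma> (ula_chain gradU \<gamma> Z x) N n f \<omega> = S (R \<omega>)" for \<omega>
    unfolding S_def weighted_avg_def X_def R_def
    by (intro sum.cong refl arg_cong2[where f = "(*)"] arg_cong[where f = f] ula_chain_restrict[symmetric])
       (auto simp: K_def)
  have E_S: "integral\<^sup>L M (weighted_avg \<gamma> (ula_chain gradU \<gamma> Z x) N n f) = expectation S"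
    unfolding distr_R[symmetric] S_R[THEN ext] using R S_PiM by (simp add: integral_distr)
  have "measure M {\<omega> \<in> space M. S (R \<omega>) \<ge> expectation S + r}
      = measure M (R -` {a \<in> space \<mu>. S a \<ge> expectation S + r} \<inter> space M)"
    using measurable_space[OF R] sets_eq_imp_space_eq[OF sets_\<mu>]
    by (intro arg_cong[where f = "measure M"]) auto
  also have "\<dots> = prob {a \<in> space \<mu>. S a \<ge> expectation S + r}"
  proof -
    have "{a \<in> space \<mu>. S a \<ge> expectation S + r} \<in> sets \<mu>" using S_\<mu> by measurable
    then have "measure (distr M (PiM {1..K} (\<lambda>_. borel)) R) {a \<in> space \<mu>. S a \<ge> expectation S + r}
       = measure M (R -` {a \<in> space \<mu>. S a \<ge> expectation S + r} \<inter> space M)"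
      unfolding sets_\<mu> by (rule measure_distr[OF R])
    then show ?thesis unfolding distr_R by simp
  qed
  finally have to_\<mu>: "measure M {\<omega> \<in> space M. S (R \<omega>) \<ge> expectation S + r}
     = prob {a \<in> space \<mu>. S a \<ge> expectation S + r}" .

  \<comment> \<open>The Lipschitz constant of the estimator\<close>
  define \<sigma> where "\<sigma> = F / \<Gamma> * sqrt (8 / \<kappa>\<^sup>2 * (1 / \<kappa> + \<Gamma>))"
  have lip: "\<bar>S a - S b\<bar> \<le> \<sigma> * sqrt (q a b)" for a b
  proof -
    interpret perturbed_contraction \<gamma> "\<lambda>k. norm (X k a - X k b)" "\<lambda>k. norm (a k - b k)" \<kappa>
    proof
      show "\<kappa> > 0" by (rule kappa)
      show "\<kappa> * \<gamma> k \<le> 1" if "k \<ge> 1" for k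
        unfolding \<kappa>_def using steps_pos step_le that by (intro kappa_step_le_1) auto
      show "norm (X 0 a - X 0 b) = 0" by (simp add: X_def)
      fix k
      let ?T = "\<lambda>y. y - \<gamma> (Suc k) *\<^sub>R gradU y"
      have "X (Suc k) a - X (Suc k) b
         = (?T (X k a) - ?T (X k b)) + sqrt (2 * \<gamma> (Suc k)) *\<^sub>R (a (Suc k) - b (Suc k))"
        by (simp add: X_def algebra_simps)
      also have "norm \<dots> \<le> norm (?T (X k a) - ?T (X k b)) + sqrt (2 * \<gamma> (Suc k)) * norm (a (Suc k) - b (Suc k))"
        using steps_pos[of "Suc k"] by (intro norm_triangle_le) simp
      also have "\<dots> \<le> sqrt (1 - \<kappa> * \<gamma> (Suc k)) * norm (X k a - X k b)
         + sqrt (2 * \<gamma> (Suc k)) * norm (a (Suc k) - b (Suc k))"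
        unfolding \<kappa>_def using steps_pos step_le by (intro add_right_mono gradient_step_contraction) auto
      finally show "norm (X (Suc k) a - X (Suc k) b) \<le> sqrt (1 - \<kappa> * \<gamma> (Suc k)) * norm (X k a - X k b)
         + sqrt (2 * \<gamma> (Suc k)) * norm (a (Suc k) - b (Suc k))" .
    qed (use steps_pos in auto)
    have "S a - S b = (\<Sum>k=N+1..N+n. avg_weight \<gamma> N n k * (f (X k a) - f (X k b)))"
      by (simp add: S_def weighted_avg_def sum_subtractf right_diff_distrib)
    also have "\<bar>\<dots>\<bar> \<le> (\<Sum>k=N+1..N+n. \<bar>avg_weight \<gamma> N n k * (f (X k a) - f (X k b))\<bar>)"
      by (rule sum_abs)
    \<comment> \<open>The weights contribute \<open>1 / \<Gamma>\<close> and \<open>f\<close>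
      contributes \<open>F\<close>; what remains is the sum estimated in
      \<open>weighted_delta_bound\<close>.\<close>
    also have "\<dots> \<le> (\<Sum>k=N+1..N+n. F / \<Gamma> * (\<gamma> (k + 1) * norm (X k a - X k b)))"
    proof (rule sum_mono)
      fix k
      have w: "avg_weight \<gamma> N n k = \<gamma> (k + 1) / \<Gamma>" "\<gamma> (k + 1) / \<Gamma> \<ge> 0"
        using steps_pos[of "k + 1"] \<Gamma> by (auto simp: avg_weight_def \<Gamma>_def)
      then have "\<bar>avg_weight \<gamma> N n k * (f (X k a) - f (X k b))\<bar>
          \<le> \<gamma> (k + 1) / \<Gamma> * (F * norm (X k a - X k b))"
        unfolding abs_mult using f_le by (intro mult_mono) auto
      then show "\<bar>avg_weight \<gamma> N n k * (f (X k a) - f (X k b))\<bar>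
          \<le> F / \<Gamma> * (\<gamma> (k + 1) * norm (X k a - X k b))" by (simp add: mult_ac)
    qed
    also have "\<dots> = F / \<Gamma> * (\<Sum>k=N+1..N+n. \<gamma> (k + 1) * norm (X k a - X k b))"
      by (simp only: sum_distrib_left)
    also have "\<dots> \<le> F / \<Gamma> * (sqrt (8 / \<kappa>\<^sup>2 * (1 / \<kappa> + \<Gamma>)) * sqrt (q a b))"
      unfolding \<Gamma>_def q_def K_def using F \<Gamma> n
      by (intro mult_left_mono weighted_delta_bound) (auto simp: \<Gamma>_def)
    finally show ?thesis by (simp add: \<sigma>_def mult.assoc)
  qed

  \<comment> \<open>The concentration bound\<close>
  show ?thesis
  proof (cases "F = 0")
    case True
    \<comment> \<open>For constant \<open>f\<close> the estimator is constant, so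
      \<open>r > 0\<close> makes the event empty, in agreement with the bound 0.\<close>
    then have "S a = S b" for a b using lip[of a b] by (simp add: \<sigma>_def)
    then have const: "S = (\<lambda>_. S undefined)" by (intro ext)
    have "expectation S = S undefined" by (subst const) (simp add: prob_space)
    then have "{a \<in> space \<mu>. S a \<ge> expectation S + r} = {}"
      using r const by (auto simp: not_le) (metis less_add_same_cancel1)
    then have "prob {a \<in> space \<mu>. S a \<ge> expectation S + r} = 0" by (simp only: measure_empty)
    then show ?thesis
      using True unfolding concentration_bound_def F_def[symmetric] S_R E_S to_\<mu> by simp
  next
    case False
    then have Fpos: "F > 0" using F by simp
    define v where "v = v_const m L \<gamma> N n"
    have v: "v = 1 + (1 / \<kappa> + 2 / (m + L)) / \<Gamma>"
      by (simp add: v_def v_const_def \<kappa>_def \<Gamma>_def)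
    have mL: "2 / (m + L) > 0" using m L_pos by simp
    \<comment> \<open>Chosen so that \<open>r^2 / (2 * V)\<close> is the required exponent; the 16
      there is \<open>2 * 8\<close>.\<close>
    define V where "V = 8 * F\<^sup>2 * v / (\<kappa>\<^sup>2 * \<Gamma>)"
    have vpos: "v > 0" unfolding v using kappa \<Gamma> m L_pos by (intro add_pos_pos divide_pos_pos) auto
    have Vpos: "V > 0" unfolding V_def using Fpos kappa \<Gamma> vpos by simp
    have "\<sigma>\<^sup>2 = (F / \<Gamma>)\<^sup>2 * (8 / \<kappa>\<^sup>2 * (1 / \<kappa> + \<Gamma>))"
      unfolding \<sigma>_def power_mult_distrib using kappa \<Gamma> by (simp add: add_nonneg_nonneg)
    \<comment> \<open>Adding \<open>2 / (m + L)\<close> turns the last factor into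
      \<open>\<Gamma> * v\<close>, and one \<open>\<Gamma>\<close> cancels.\<close>
    also have "\<dots> \<le> (F / \<Gamma>)\<^sup>2 * (8 / \<kappa>\<^sup>2 * (1 / \<kappa> + 2 / (m + L) + \<Gamma>))"
      using mL by (intro mult_left_mono) auto
    also have "1 / \<kappa> + 2 / (m + L) + \<Gamma> = \<Gamma> * v"
    proof -
      have "c + \<Gamma> = \<Gamma> * (1 + c / \<Gamma>)" for c using \<Gamma> by (simp add: distrib_left)
      then show ?thesis unfolding v .
    qed
    also have "(F / \<Gamma>)\<^sup>2 * (8 / \<kappa>\<^sup>2 * (\<Gamma> * v)) = V"
      unfolding V_def using \<Gamma> kappa by (simp add: power_divide power2_eq_square mult_ac)
    finally have "\<sigma>\<^sup>2 \<le> V" .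
    then have "prob {a \<in> space \<mu>. S a \<ge> expectation S + r} \<le> exp (- r\<^sup>2 / (2 * V))"
      using lip Vpos r by (intro concentration_lipschitz[OF S_\<mu>]) auto
    also have "- r\<^sup>2 / (2 * V) = - (r\<^sup>2 * \<kappa>\<^sup>2 * \<Gamma> / (16 * F\<^sup>2 * v))"
      unfolding V_def using Fpos kappa \<Gamma> vpos by (simp add: field_simps)
    also have "exp \<dots> = concentration_bound m L \<gamma> N n f r"
      using False by (simp add: concentration_bound_def F_def \<kappa>_def \<Gamma>_def v_def)
    finally show ?thesis unfolding S_R E_S to_\<mu> .
  qed
qed

end
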